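(* Let $(X,\tau)$ be a (real) Hausdorff locally convex space such that there is a metrizable locally convex topology $\rho$ on $X$ compatible with the duality, i.e. with $(X,\rho)^*=(X,\tau)^*$. The following assertions are equivalent: (i) Any bounded subset of $X$ is Fréchet-Urysohn in the weak topology. (ii) Any bounded sequence in $X$ has a weakly Cauchy subsequence. If, moreover, $\tau$ itself is metrizable, then these assertions are equivalent also to the following one: (iii) $X$ contains no $\ell_1$-sequence.
   Context: Vector spaces are real. $X^*=(X,\tau)^*$ and the weak topology is $\sigma(X,X^* )$. A topological space $S$ is Fréchet-Urysohn if whenever $A\subset S$ and $x\in\overline{A}$ (closure in $S$), there is a sequence $(x_n)$ in $A$ with $x_n\to x$; a subset of $X$ is Fréchet-Urysohn in the weak topology if it is so as a subspace of $(X,\sigma(X,X^* ))$. A sequence $(x_n)$ is weakly Cauchy if $(x^*(x_n))_n$ is a Cauchy sequence of reals for each $x^*\in X^*$. Let $\ell_1^0$ be the subspace of $\ell_1$ formed by elements with only finitely many nonzero coordinates, equipped with the $\ell_1$-norm. A sequence $(x_n)$ in a topological vector space $X$ is an $\ell_1$-sequence if the linear mapping $T_0\colon\ell_1^0\to X$, $T_0((a_i)_{i=1}^\infty)=\sum_{i=1}^\infty a_ix_i$, is an isomorphism (linear homeomorphism) of $\ell_1^0$ onto $T_0(\ell_1^0)$. *)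

theory Defs
  imports "HOL-Analysis.Analysis"
begin

text \<open>
  A vector space \<open>X\<close> is a type of class \<^class>\<open>real_vector\<close>. As several topologies on the same
  space are compared, topologies are values of type \<open>'a topology\<close> with underlying set \<open>UNIV\<close>.
\<close>

definition locally_convex_topology :: "'a::real_vector topology \<Rightarrow> bool" where
  "locally_convex_topology \<tau> \<longleftrightarrow>
     topspace \<tau> = UNIV \<and>
     continuous_map (prod_topology \<tau> \<tau>) \<tau> (\<lambda>(x, y). x + y) \<and>
     continuous_map (prod_topology euclideanreal \<tau>) \<tau> (\<lambda>(c, x). c *\<^sub>R x) \<and>
     neighbourhood_base_at 0 convex \<tau>"

definition dual_space :: "'a::real_vector topology \<Rightarrow> ('a \<Rightarrow> real) set" where
  "dual_space \<tau> = {f. linear f \<and> continuous_map \<tau> euclideanreal f}"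

definition weak_topology :: "'a::real_vector topology \<Rightarrow> 'a topology" where
  "weak_topology \<tau> = topology_generated_by {f -` U | f U. f \<in> dual_space \<tau> \<and> open U}"

lemma topspace_weak_topology [simp]: "topspace (weak_topology \<tau>) = UNIV"
proof -
  have "(\<lambda>x. 0) \<in> dual_space \<tau>"
    by (simp add: dual_space_def linear_zero)
  then have "UNIV \<in> {f -` U | f U. f \<in> dual_space \<tau> \<and> open U}"
    by (smt (verit) mem_Collect_eq open_UNIV vimage_UNIV)
  then show ?thesis
    unfolding weak_topology_def topology_generated_by_topspace by blast
qed

definition von_neumann_bounded :: "'a::real_vector topology \<Rightarrow> 'a set \<Rightarrow> bool" where
  "von_neumann_bounded \<tau> B \<longleftrightarrow>
     (\<forall>U. openin \<tau> U \<and> 0 \<in> U \<longrightarrow> (\<exists>s>0. \<forall>t>s. B \<subseteq> (\<lambda>x. t *\<^sub>R x) ` U))"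

definition frechet_urysohn_space :: "'a topology \<Rightarrow> bool" where
  "frechet_urysohn_space S \<longleftrightarrow>
     (\<forall>A x. A \<subseteq> topspace S \<and> x \<in> S closure_of A \<longrightarrow>
        (\<exists>y :: nat \<Rightarrow> 'a. range y \<subseteq> A \<and> limitin S y x sequentially))"

definition weakly_Cauchy :: "'a::real_vector topology \<Rightarrow> (nat \<Rightarrow> 'a) \<Rightarrow> bool" where
  "weakly_Cauchy \<tau> x \<longleftrightarrow> (\<forall>f \<in> dual_space \<tau>. Cauchy (\<lambda>n. f (x n)))"

definition l1 :: "(nat \<Rightarrow> real) set" where
  "l1 = {a. (\<lambda>i. \<bar>a i\<bar>) summable_on UNIV}"

definition l1_norm :: "(nat \<Rightarrow> real) \<Rightarrow> real" where
  "l1_norm a = (\<Sum>\<^sub>\<infinity>i. \<bar>a i\<bar>)"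

definition l1_dist :: "(nat \<Rightarrow> real) \<Rightarrow> (nat \<Rightarrow> real) \<Rightarrow> real" where
  "l1_dist a b = l1_norm (\<lambda>i. a i - b i)"

lemma Metric_space_l1: "Metric_space l1 l1_dist"
proof
  have sm: "(\<lambda>i. \<bar>a i - b i\<bar>) summable_on UNIV" if "a \<in> l1" "b \<in> l1" for a b :: "nat \<Rightarrow> real"
  proof (rule summable_on_comparison_test)
    show "(\<lambda>i. \<bar>a i\<bar> + \<bar>b i\<bar>) summable_on UNIV"
      using that by (intro summable_on_add) (auto simp: l1_def)
  qed (auto intro: abs_triangle_ineq4)
  show "0 \<le> l1_dist a b" for a b
    by (simp add: l1_dist_def l1_norm_def infsum_nonneg)
  show "l1_dist a b = l1_dist b a" for a b
    by (simp add: l1_dist_def l1_norm_def abs_minus_commute)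
  show "l1_dist a b = 0 \<longleftrightarrow> a = b" if "a \<in> l1" "b \<in> l1" for a b
  proof
    assume "l1_dist a b = 0"
    then have "\<bar>a i - b i\<bar> = 0" for i
      using nonneg_infsum_le_0D[of "\<lambda>i. \<bar>a i - b i\<bar>" UNIV i] sm[OF that]
      by (simp add: l1_dist_def l1_norm_def)
    then show "a = b" by auto
  qed (simp add: l1_dist_def l1_norm_def)
  show "l1_dist a c \<le> l1_dist a b + l1_dist b c" if "a \<in> l1" "b \<in> l1" "c \<in> l1" for a b c
  proof -
    have "l1_dist a c \<le> (\<Sum>\<^sub>\<infinity>i. \<bar>a i - b i\<bar> + \<bar>b i - c i\<bar>)"
      unfolding l1_dist_def l1_norm_def
      by (intro infsum_mono sm summable_on_add that) auto
    also have "\<dots> = l1_dist a b + l1_dist b c"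
      unfolding l1_dist_def l1_norm_def by (intro infsum_add sm that)
    finally show ?thesis .
  qed
qed

definition l1_finite :: "(nat \<Rightarrow> real) set" where
  "l1_finite = {a \<in> l1. finite {i. a i \<noteq> 0}}"

definition l1_finite_topology :: "(nat \<Rightarrow> real) topology" where
  "l1_finite_topology = subtopology (Metric_space.mtopology l1 l1_dist) l1_finite"

definition l1_operator :: "(nat \<Rightarrow> 'a::real_vector) \<Rightarrow> (nat \<Rightarrow> real) \<Rightarrow> 'a" where
  "l1_operator x a = (\<Sum>i | a i \<noteq> 0. a i *\<^sub>R x i)"

text \<open>
  An \<^const>\<open>embedding_map\<close> is a homeomorphism onto its image with the subspace topology.
  Linearity of \<^const>\<open>l1_operator\<close> on \<^const>\<open>l1_finite\<close> is automatic.
\<close>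

definition l1_sequence :: "'a::real_vector topology \<Rightarrow> (nat \<Rightarrow> 'a) \<Rightarrow> bool" where
  "l1_sequence \<tau> x \<longleftrightarrow> embedding_map l1_finite_topology \<tau> (l1_operator x)"

end

theory Submission
  imports Defs
begin

text \<open>
  By metrizability of \<open>\<rho>\<close>, the dual is a countable union of polars, which are pointwise compact.
  For an ultrafilter \<open>U\<close> and \<open>lo < hi\<close>, a closed game on a polar is decided: either some tree with
  branching in \<open>U\<close> has only branches \<open>u\<close> on which a functional of the polar alternates
  between \<open>\<ge> hi\<close> and \<open>\<le> lo\<close>, or some such tree has no such branch.
  In the first case a suitable branch has all its subsequences alternating, hence no weakly
  Cauchy subsequence. With a free ultrafilter on the naturals this gives Rosenthal's
  dichotomy: a bounded sequence has a weakly Cauchy subsequence or one with independent values on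
  a polar. If \<open>\<tau>\<close> is metrizable, the latter is an l1-sequence; conversely, by Hahn--Banach an
  l1-sequence has no weakly Cauchy subsequence.

  (ii) implies (i): the weak topology has countable tightness, and if \<open>U\<close> is an ultrafilter on a
  countable subset of \<open>A\<close> converging weakly to \<open>x\<close>, (ii) leaves only the second case; a sequence
  that is eventually admissible at each of the countably many nodes then converges weakly to \<open>x\<close>,
  since otherwise, mixing it with points chosen along \<open>U\<close>, one obtains an alternating branch.

  (i) implies (ii): if \<open>z\<close> is independent, \<open>0\<close> is in the weak closure of the differences
  \<open>z i - z j\<close> with \<open>i < j\<close>, but a set that contains \<open>i\<close> and not \<open>j\<close> for infinitely many terms of a
  given sequence of differences yields a functional along which that sequence does not tend to \<open>0\<close>.
\<close>

section \<open>Ultrafilters and trees\<close>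

definition ultrafilter :: "'b filter \<Rightarrow> bool" where
  "ultrafilter U \<longleftrightarrow> U \<noteq> bot \<and> (\<forall>P. eventually P U \<or> eventually (\<lambda>x. \<not> P x) U)"

lemma ultrafilter_not_bot: "ultrafilter U \<Longrightarrow> U \<noteq> bot"
  by (simp add: ultrafilter_def)

lemma ultrafilter_eventually_not_iff:
  assumes "ultrafilter U"
  shows "eventually (\<lambda>x. \<not> P x) U \<longleftrightarrow> \<not> eventually P U"
proof
  assume "eventually (\<lambda>x. \<not> P x) U"
  show "\<not> eventually P U"
  proof
    assume "eventually P U"
    with \<open>eventually (\<lambda>x. \<not> P x) U\<close> have "eventually (\<lambda>x. False) U"
      by eventually_elim auto
    then show False
      using assms by (simp add: ultrafilter_def trivial_limit_def)
  qed
qed (use assms in \<open>auto simp: ultrafilter_def\<close>)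

lemma ultrafilter_eventually_Bex:
  assumes "ultrafilter U" "finite I" "eventually (\<lambda>x. \<exists>i\<in>I. P i x) U"
  shows "\<exists>i\<in>I. eventually (P i) U"
proof (rule ccontr)
  assume "\<not> ?thesis"
  then have "\<forall>i\<in>I. eventually (\<lambda>x. \<not> P i x) U"
    by (simp add: ultrafilter_eventually_not_iff[OF assms(1)])
  then have "eventually (\<lambda>x. \<forall>i\<in>I. \<not> P i x) U"
    using assms(2) by (simp add: eventually_ball_finite)
  then have "eventually (\<lambda>x. \<not> (\<exists>i\<in>I. P i x)) U"
    by simp
  then show False
    unfolding ultrafilter_eventually_not_iff[OF assms(1)] using assms(3) by blast
qed

text \<open>Zorn's lemma applied to the proper filters below \<open>F\<close>. The infimum of a
  chain is proper because whatever holds eventually in it already does so in some member. A minimal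
  proper filter decides every \<open>P\<close>: if it does not contain the negation, adjoining
  \<open>P\<close> keeps it proper and hence does not change it.\<close>

lemma ultrafilter_exists:
  assumes "F \<noteq> bot"
  shows "\<exists>U\<le>F. ultrafilter U"
proof -
  let ?A = "{G. G \<le> F \<and> G \<noteq> bot}" and ?P = "\<lambda>a b. (b::'a filter) \<le> a"
  have "\<exists>m\<in>?A. \<forall>a\<in>?A. ?P m a \<longrightarrow> a = m"
  proof (rule predicate_Zorn)
    show "partial_order_on ?A (relation_of ?P ?A)"
      by (rule partial_order_on_relation_ofI) auto
  next
    fix C assume C: "C \<in> Chains (relation_of ?P ?A)"
    then have sub: "C \<subseteq> ?A" and lin: "\<And>G H. G \<in> C \<Longrightarrow> H \<in> C \<Longrightarrow> G \<le> H \<or> H \<le> G"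
      unfolding Chains_def relation_of_def by blast+
    show "\<exists>u\<in>?A. \<forall>a\<in>C. ?P a u"
    proof (cases "C = {}")
      case True
      then show ?thesis using assms by auto
    next
      case False
      have "eventually (\<lambda>x. False) (Inf C) \<longleftrightarrow> (\<exists>b\<in>C. eventually (\<lambda>x. False) b)"
      proof (rule eventually_Inf_base[OF False])
        show "\<exists>x\<in>C. x \<le> inf G H" if "G \<in> C" "H \<in> C" for G H
          using lin[OF that] that by (metis inf.order_iff order_refl inf.commute)
      qed
      then have "Inf C \<noteq> bot"
        using sub by (auto simp: trivial_limit_def)
      moreover have "Inf C \<le> F"
        using False sub by (auto intro: Inf_lower2)
      ultimately show ?thesis
        by (intro bexI[of _ "Inf C"]) (auto intro: Inf_lower)
    qed
  qed
  then obtain U where U: "U \<le> F" "U \<noteq> bot" "\<And>G. G \<le> F \<Longrightarrow> G \<noteq> bot \<Longrightarrow> G \<le> U \<Longrightarrow> G = U"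
    by auto
  have "eventually P U" if "\<not> eventually (\<lambda>x. \<not> P x) U" for P
  proof -
    have "inf U (principal {x. P x}) \<noteq> bot"
      using that by (simp add: trivial_limit_def eventually_inf_principal)
    then have "inf U (principal {x. P x}) = U"
      using U by (meson inf.cobounded1 order_trans)
    moreover have "eventually P (inf U (principal {x. P x}))"
      by (simp add: eventually_inf_principal)
    ultimately show ?thesis by simp
  qed
  with U show ?thesis
    unfolding ultrafilter_def by blast
qed

text \<open>Compactness of the interval gives a cluster point of the image filter, and for an
  ultrafilter a cluster point is a limit.\<close>

lemma ultrafilter_bounded_tendsto:
  fixes g :: "'b \<Rightarrow> real"
  assumes U: "ultrafilter U" and ev: "eventually (\<lambda>i. \<bar>g i\<bar> \<le> c) U"
  shows "\<exists>l. (g \<longlongrightarrow> l) U"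
proof -
  have "eventually (\<lambda>y. y \<in> {-c..c}) (filtermap g U)"
    using ev by (auto simp: eventually_filtermap elim!: eventually_mono)
  moreover have "filtermap g U \<noteq> bot"
    using U by (simp add: filtermap_bot_iff ultrafilter_not_bot)
  ultimately obtain l where l: "inf (nhds l) (filtermap g U) \<noteq> bot"
    using compact_filter[of "{-c..c}"] compact_Icc by blast
  have "eventually (\<lambda>i. g i \<in> S) U" if "open S" "l \<in> S" for S
  proof (rule ccontr)
    assume "\<not> ?thesis"
    then have "eventually (\<lambda>i. g i \<notin> S) U"
      by (simp add: ultrafilter_eventually_not_iff[OF U])
    then have "eventually (\<lambda>y. y \<notin> S) (filtermap g U)"
      by (simp add: eventually_filtermap)
    moreover have "eventually (\<lambda>y. y \<in> S) (nhds l)"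
      using that by (simp add: eventually_nhds_in_open)
    ultimately have "eventually (\<lambda>y. False) (inf (nhds l) (filtermap g U))"
      by (auto simp: eventually_inf)
    with l show False by (simp add: trivial_limit_def)
  qed
  then show ?thesis
    by (auto simp: tendsto_def)
qed

text \<open>
  \<open>G s\<close> is the set of admissible successors of the node \<open>s\<close>, so \<open>branch G u\<close> says that \<open>u\<close> is an
  infinite branch of the tree determined by \<open>G\<close>; for an ultrafilter \<open>U\<close>, the trees with all
  \<open>G s\<close> in \<open>U\<close> play the role of homogeneous sets in Ramsey's theorem.
\<close>

definition branch :: "('b list \<Rightarrow> 'b \<Rightarrow> bool) \<Rightarrow> (nat \<Rightarrow> 'b) \<Rightarrow> bool" where
  "branch G u \<longleftrightarrow> (\<forall>n. G (map u [0..<n]) (u n))"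

lemma map_upt_Suc_shift: "map u [0..<Suc n] = u 0 # map (u \<circ> Suc) [0..<n]"
  by (simp add: map_upt_Suc del: upt_Suc)

text \<open>Determinacy of a closed game, without ranks. A node \<open>s\<close> is
  \<open>bad\<close> if some U-large tree above it has only branches that leave \<open>P\<close>.
  Badness passes from U-many children to their parent, so from a root that is not bad one can stay
  on nodes that are not bad, and there \<open>P\<close> holds because a node violating
  \<open>P\<close> is bad at once.\<close>

lemma ultrafilter_tree_dichotomy:
  assumes U: "ultrafilter U"
  shows "\<exists>G. (\<forall>s. eventually (G s) U) \<and>
    ((\<forall>u. branch G u \<longrightarrow> (\<forall>n. P (map u [0..<n]))) \<or>
     (\<forall>u. branch G u \<longrightarrow> (\<exists>n. \<not> P (map u [0..<n]))))"
proof -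
  define bad where "bad s \<longleftrightarrow> (\<exists>G. (\<forall>t. eventually (G t) U) \<and>
    (\<forall>u. branch G u \<longrightarrow> (\<exists>n. \<not> P (s @ map u [0..<n]))))" for s
  have step: "bad s" if ev: "eventually (\<lambda>a. bad (s @ [a])) U" for s
  proof -
    have "\<forall>a. \<exists>G. bad (s @ [a]) \<longrightarrow> (\<forall>t. eventually (G t) U) \<and>
       (\<forall>u. branch G u \<longrightarrow> (\<exists>n. \<not> P ((s @ [a]) @ map u [0..<n])))"
      unfolding bad_def by blast
    then obtain H where H: "\<And>a. bad (s @ [a]) \<Longrightarrow> (\<forall>t. eventually (H a t) U) \<and>
       (\<forall>u. branch (H a) u \<longrightarrow> (\<exists>n. \<not> P ((s @ [a]) @ map u [0..<n])))"
      by metis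
    \<comment> \<open>The trees witnessing badness of the children are glued: the root admits only
      bad children, and above each of them the chosen tree is followed. The value
      \<open>True\<close> above the other children only keeps every \<open>G t\<close> in
      \<open>U\<close>; no branch gets there.\<close>
    define G where "G t = (case t of [] \<Rightarrow> (\<lambda>a. bad (s @ [a]))
        | a # t' \<Rightarrow> (if bad (s @ [a]) then H a t' else (\<lambda>_. True)))" for t
    have "eventually (G t) U" for t
      using ev H by (cases t) (auto simp: G_def)
    moreover have "\<exists>n. \<not> P (s @ map u [0..<n])" if u: "branch G u" for u
    proof -
      have b: "bad (s @ [u 0])"
        using u[unfolded branch_def, rule_format, of 0] by (simp add: G_def)
      have "branch (H (u 0)) (u \<circ> Suc)"
        unfolding branch_def
      proof
        fix n
        show "H (u 0) (map (u \<circ> Suc) [0..<n]) ((u \<circ> Suc) n)"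
          using u[unfolded branch_def, rule_format, of "Suc n"] b
          by (simp only: map_upt_Suc_shift) (simp add: G_def)
      qed
      then obtain n where "\<not> P ((s @ [u 0]) @ map (u \<circ> Suc) [0..<n])"
        using H[OF b] by blast
      then have "\<not> P (s @ map u [0..<Suc n])"
        by (simp only: map_upt_Suc_shift) simp
      then show ?thesis by blast
    qed
    ultimately show ?thesis
      unfolding bad_def by blast
  qed
  show ?thesis
  proof (cases "bad []")
    case True
    then show ?thesis by (auto simp: bad_def)
  next
    case False
    \<comment> \<open>The disjunct \<open>bad s\<close> keeps \<open>G s\<close> in \<open>U\<close>
      at bad nodes; branches never visit these, since the root is not bad.\<close>
    define G where "G s = (\<lambda>a. bad s \<or> \<not> bad (s @ [a]))" for s
    have "eventually (G s) U" for s
      using step[of s] U by (cases "bad s") (auto simp: G_def ultrafilter_eventually_not_iff)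
    moreover have "P (map u [0..<n])" if u: "branch G u" for u n
    proof -
      have "\<not> bad (map u [0..<n])" for n
      proof (induction n)
        case 0
        then show ?case using False by simp
      next
        case (Suc n)
        then show ?case
          using u[unfolded branch_def, rule_format, of n] by (simp add: G_def)
      qed
      moreover have "bad s" if "\<not> P s" for s
        unfolding bad_def using that
        by (intro exI[of _ "\<lambda>_ _. True"]) (auto intro!: exI[of _ 0])
      ultimately show ?thesis by blast
    qed
    ultimately show ?thesis by blast
  qed
qed

text \<open>Diagonal choice: the term \<open>a n\<close> is taken admissible, for every tree of
  index at most \<open>n\<close>, after each list of length at most \<open>n\<close> over the
  earlier terms. These are finitely many U-large conditions. Every prefix of a subsequence is such a
  list, so each subsequence that starts late enough is again a branch.\<close>

lemma ultrafilter_hereditary_branch: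
  fixes G :: "nat \<Rightarrow> 'b list \<Rightarrow> 'b \<Rightarrow> bool"
  assumes U: "ultrafilter U" and G: "\<And>j s. eventually (G j s) U"
  shows "\<exists>a. \<forall>j \<kappa>. strict_mono \<kappa> \<and> j \<le> \<kappa> 0 \<longrightarrow> branch (G j) (a \<circ> \<kappa>)"
proof -
  have "\<exists>a. \<forall>n. \<forall>j\<le>n. \<forall>s. set s \<subseteq> a ` {..<n} \<and> length s \<le> n \<longrightarrow> G j s (a n)"
  proof (rule dependent_wellorder_choice)
    fix r and f g :: "nat \<Rightarrow> 'b" and n :: nat
    assume "\<And>y. y < n \<Longrightarrow> f y = g y"
    then have "f ` {..<n} = g ` {..<n}" by auto
    then show "(\<forall>j\<le>n. \<forall>s. set s \<subseteq> f ` {..<n} \<and> length s \<le> n \<longrightarrow> G j s r) =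
               (\<forall>j\<le>n. \<forall>s. set s \<subseteq> g ` {..<n} \<and> length s \<le> n \<longrightarrow> G j s r)"
      by simp
  next
    fix n :: nat and f :: "nat \<Rightarrow> 'b"
    have fin: "finite {s. set s \<subseteq> f ` {..<n} \<and> length s \<le> n}"
      by (rule finite_lists_length_le) simp
    have "eventually (\<lambda>r. \<forall>j\<in>{..n}. \<forall>s\<in>{s. set s \<subseteq> f ` {..<n} \<and> length s \<le> n}. G j s r) U"
      by (intro eventually_ball_finite ballI fin G) auto
    then obtain r where "\<forall>j\<in>{..n}. \<forall>s\<in>{s. set s \<subseteq> f ` {..<n} \<and> length s \<le> n}. G j s r"
      using eventually_happens' ultrafilter_not_bot[OF U] by blast
    then show "\<exists>r. \<forall>j\<le>n. \<forall>s. set s \<subseteq> f ` {..<n} \<and> length s \<le> n \<longrightarrow> G j s r"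
      by (intro exI[of _ r]) auto
  qed
  then obtain a where a: "\<And>n j s. j \<le> n \<Longrightarrow> set s \<subseteq> a ` {..<n} \<Longrightarrow> length s \<le> n \<Longrightarrow> G j s (a n)"
    by blast
  have "branch (G j) (a \<circ> \<kappa>)" if \<kappa>: "strict_mono \<kappa>" "j \<le> \<kappa> 0" for j \<kappa>
    unfolding branch_def
  proof
    fix n
    have "\<kappa> 0 \<le> \<kappa> n"
      using \<kappa>(1) by (simp add: strict_mono_less_eq)
    moreover have "set (map (a \<circ> \<kappa>) [0..<n]) \<subseteq> a ` {..<\<kappa> n}"
      using \<kappa>(1) by (auto simp: strict_mono_less)
    moreover have "n \<le> \<kappa> n"
      using \<kappa>(1) by (rule strict_mono_imp_increasing)
    ultimately show "G j (map (a \<circ> \<kappa>) [0..<n]) ((a \<circ> \<kappa>) n)"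
      using \<kappa>(2) by (auto intro!: a)
  qed
  then show ?thesis by blast
qed

section \<open>Polars and weak topologies\<close>

lemma topspace_locally_convex: "locally_convex_topology \<tau> \<Longrightarrow> topspace \<tau> = UNIV"
  by (simp add: locally_convex_topology_def)

lemma continuous_map_affine:
  assumes "locally_convex_topology \<tau>"
  shows "continuous_map \<tau> \<tau> (\<lambda>y. c *\<^sub>R y + b)"
proof -
  have top: "topspace \<tau> = UNIV"
    and add: "continuous_map (prod_topology \<tau> \<tau>) \<tau> (\<lambda>(x, y). x + y)"
    and scale: "continuous_map (prod_topology euclideanreal \<tau>) \<tau> (\<lambda>(c, x). c *\<^sub>R x)"
    using assms by (auto simp: locally_convex_topology_def)
  have "continuous_map \<tau> (prod_topology euclideanreal \<tau>) (\<lambda>y. (c, y))"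
    by (simp add: continuous_map_pairedI)
  from continuous_map_compose[OF this scale]
  have "continuous_map \<tau> \<tau> (\<lambda>y. c *\<^sub>R y)"
    by (simp add: o_def)
  then have "continuous_map \<tau> (prod_topology \<tau> \<tau>) (\<lambda>y. (c *\<^sub>R y, b))"
    by (simp add: continuous_map_pairedI top)
  from continuous_map_compose[OF this add] show ?thesis
    by (simp add: o_def)
qed

lemma openin_affine_vimage:
  assumes "locally_convex_topology \<tau>" "openin \<tau> U"
  shows "openin \<tau> {y. c *\<^sub>R y + b \<in> U}"
  using openin_continuous_map_preimage[OF continuous_map_affine[OF assms(1), of c b] assms(2)]
  by (simp add: topspace_locally_convex[OF assms(1)])

lemma convex_neighbourhood:
  assumes "locally_convex_topology \<tau>" "openin \<tau> U" "0 \<in> U"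
  obtains V N where "openin \<tau> V" "0 \<in> V" "V \<subseteq> N" "N \<subseteq> U" "convex N"
  using assms by (auto simp: locally_convex_topology_def neighbourhood_base_at_def)

lemma symmetric_neighbourhood:
  assumes "locally_convex_topology \<tau>" "openin \<tau> U" "0 \<in> U"
  shows "openin \<tau> (U \<inter> {y. - y \<in> U})" "0 \<in> U \<inter> {y. - y \<in> U}"
  using openin_affine_vimage[OF assms(1,2), of "-1" 0] assms by auto

text \<open>One positive multiple per vector is asked for. This is what bounds a polar pointwise and
  makes \<open>gauge_set\<close> nonempty.\<close>

definition absorbing :: "'a::real_vector set \<Rightarrow> bool" where
  "absorbing V \<longleftrightarrow> (\<forall>x. \<exists>c>0. c *\<^sub>R x \<in> V)"

lemma absorbing_neighbourhood:
  assumes lc: "locally_convex_topology \<tau>" and U: "openin \<tau> U" "0 \<in> U"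
  shows "absorbing U"
  unfolding absorbing_def
proof
  fix x
  have top: "topspace \<tau> = UNIV"
    and scale: "continuous_map (prod_topology euclideanreal \<tau>) \<tau> (\<lambda>(c, x). c *\<^sub>R x)"
    using lc by (auto simp: locally_convex_topology_def)
  have "continuous_map euclideanreal (prod_topology euclideanreal \<tau>) (\<lambda>c. (c, x))"
    by (simp add: continuous_map_pairedI top)
  from continuous_map_compose[OF this scale]
  have "continuous_map euclideanreal \<tau> (\<lambda>c. c *\<^sub>R x)"
    by (simp add: o_def)
  from openin_continuous_map_preimage[OF this U(1)]
  have "open {c. c *\<^sub>R x \<in> U}" by simp
  moreover have "0 \<in> {c. c *\<^sub>R x \<in> U}" using U(2) by simp
  ultimately obtain e where "e > 0" "\<And>c. dist c 0 < e \<Longrightarrow> c \<in> {c. c *\<^sub>R x \<in> U}"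
    unfolding open_dist by blast
  then show "\<exists>c>0. c *\<^sub>R x \<in> U"
    by (intro exI[of _ "e/2"]) auto
qed

text \<open>The absolute polar inside the algebraic dual. Leaving continuity out makes pointwise
  compactness depend on absorption alone; for neighbourhoods of 0, continuity is recovered in
  \<open>polar_subset_dual_space\<close>.\<close>

definition polar :: "'a::real_vector set \<Rightarrow> ('a \<Rightarrow> real) set" where
  "polar V = {f. linear f \<and> (\<forall>v\<in>V. \<bar>f v\<bar> \<le> 1)}"

lemma polar_antimono: "V \<subseteq> W \<Longrightarrow> polar W \<subseteq> polar V"
  by (auto simp: polar_def)

lemma polar_uminus: "f \<in> polar V \<Longrightarrow> (\<lambda>x. - f x) \<in> polar V"
  by (auto simp: polar_def intro: linear_compose_neg)

text \<open>A functional in the polar varies by at most \<open>e / 2\<close> on the translate of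
  \<open>(e / 2) V\<close> to \<open>x\<close>, which is an open set around
  \<open>x\<close>.\<close>

lemma polar_subset_dual_space:
  assumes lc: "locally_convex_topology \<tau>" and V: "openin \<tau> V" "0 \<in> V"
  shows "polar V \<subseteq> dual_space \<tau>"
proof
  fix f assume f: "f \<in> polar V"
  then have lin: "linear f" and le: "\<And>v. v \<in> V \<Longrightarrow> \<bar>f v\<bar> \<le> 1"
    by (auto simp: polar_def)
  have "openin \<tau> {x. f x \<in> W}" if "open W" for W
  proof (subst openin_subopen, intro ballI)
    fix x assume "x \<in> {x. f x \<in> W}"
    with that obtain e where e: "e > 0" "\<And>r. \<bar>r - f x\<bar> < e \<Longrightarrow> r \<in> W"
      by (auto simp: open_dist dist_real_def)
    let ?T = "{y. (2 / e) *\<^sub>R y + - ((2 / e) *\<^sub>R x) \<in> V}"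
    have "f y \<in> W" if "y \<in> ?T" for y
    proof -
      have "\<bar>(2 / e) * f y - (2 / e) * f x\<bar> \<le> 1"
        using le[of "(2 / e) *\<^sub>R y + - ((2 / e) *\<^sub>R x)"] that lin
        by (simp add: linear_diff linear_scale)
      moreover have "(2 / e) * f y - (2 / e) * f x = (2 / e) * (f y - f x)"
        by (simp only: right_diff_distrib)
      ultimately have "(2 / e) * \<bar>f y - f x\<bar> \<le> 1"
        using e(1) by (simp only: abs_mult) simp
      then have "\<bar>f y - f x\<bar> < e"
        using e(1) by (simp add: field_simps)
      then show ?thesis by (rule e)
    qed
    moreover have "openin \<tau> ?T"
      by (rule openin_affine_vimage[OF lc V(1)])
    moreover have "x \<in> ?T" using V by simp
    ultimately show "\<exists>T. openin \<tau> T \<and> x \<in> T \<and> T \<subseteq> {x. f x \<in> W}" by blast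
  qed
  then show "f \<in> dual_space \<tau>"
    using lin by (simp add: dual_space_def continuous_map_def topspace_locally_convex[OF lc])
qed

lemma dual_space_neighbourhood:
  assumes "locally_convex_topology \<tau>" "f \<in> dual_space \<tau>" "e > 0"
  shows "openin \<tau> {x. \<bar>f x\<bar> < e}"
proof -
  have "openin \<tau> {x \<in> topspace \<tau>. f x \<in> ball 0 e}"
    using assms(2) by (intro openin_continuous_map_preimage) (auto simp: dual_space_def)
  then show ?thesis
    by (simp add: topspace_locally_convex[OF assms(1)] dist_real_def)
qed

text \<open>A countable base at 0 is enumerated and replaced by its finite intersections, so that it
  decreases and the polars increase.\<close>

lemma metrizable_neighbourhood_sequence:
  assumes lc: "locally_convex_topology \<tau>" and "metrizable_space \<tau>"
  obtains V :: "nat \<Rightarrow> 'a::real_vector set"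
  where "\<And>k. openin \<tau> (V k)" "\<And>k. 0 \<in> V k" "antimono V"
    "\<And>W. openin \<tau> W \<Longrightarrow> 0 \<in> W \<Longrightarrow> \<exists>k. V k \<subseteq> W"
proof -
  from metrizable_imp_first_countable[OF assms(2)] obtain B where
    B: "countable B" "\<And>V. V \<in> B \<Longrightarrow> openin \<tau> V"
      "\<And>U. openin \<tau> U \<Longrightarrow> 0 \<in> U \<Longrightarrow> \<exists>V\<in>B. 0 \<in> V \<and> V \<subseteq> U"
    unfolding first_countable_def topspace_locally_convex[OF lc] by (metis UNIV_I)
  define B' where "B' = {V \<in> B. 0 \<in> V}"
  have "B' \<noteq> {}"
    using B(3)[of UNIV] openin_topspace[of \<tau>] by (auto simp: B'_def topspace_locally_convex[OF lc])
  moreover have "countable B'" using B(1) by (auto simp: B'_def)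
  ultimately have range: "range (from_nat_into B') = B'"
    by (rule range_from_nat_into)
  define V where "V k = (\<Inter>i\<le>k. from_nat_into B' i)" for k
  have mem: "from_nat_into B' i \<in> B'" for i using range by blast
  show thesis
  proof
    show "openin \<tau> (V k)" for k
      unfolding V_def using mem B(2) by (intro openin_INT2) (auto simp: B'_def)
    show "0 \<in> V k" for k
      unfolding V_def using mem by (auto simp: B'_def)
    show "antimono V"
      unfolding V_def by (rule antimonoI) force
    show "\<exists>k. V k \<subseteq> W" if W: "openin \<tau> W" "0 \<in> W" for W
    proof -
      obtain S where "S \<in> B'" "S \<subseteq> W"
        using B(3)[OF W] by (auto simp: B'_def)
      then obtain k where "from_nat_into B' k \<subseteq> W" using range by (metis imageE)
      then show ?thesis unfolding V_def by (intro exI[of _ k]) auto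
    qed
  qed
qed

lemma dual_space_eq_UN_polar:
  assumes lc: "locally_convex_topology \<tau>"
    and V: "\<And>k. openin \<tau> (V k)" "\<And>k. 0 \<in> V k"
    and base: "\<And>W. openin \<tau> W \<Longrightarrow> 0 \<in> W \<Longrightarrow> \<exists>k. V k \<subseteq> W"
  shows "dual_space \<tau> = (\<Union>k. polar (V k))"
proof
  show "(\<Union>k. polar (V k)) \<subseteq> dual_space \<tau>"
    using polar_subset_dual_space[OF lc V] by blast
  show "dual_space \<tau> \<subseteq> (\<Union>k. polar (V k))"
  proof
    fix f assume f: "f \<in> dual_space \<tau>"
    then have lin: "linear f" by (simp add: dual_space_def)
    obtain k where "V k \<subseteq> {x. \<bar>f x\<bar> < 1}"
      using base[OF dual_space_neighbourhood[OF lc f, of 1]] lin by (auto simp: linear_0)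
    then have "f \<in> polar (V k)" using lin by (force simp: polar_def)
    then show "f \<in> (\<Union>k. polar (V k))" by blast
  qed
qed

lemma polar_bound:
  assumes "absorbing V"
  shows "\<exists>M. \<forall>f\<in>polar V. \<bar>f x\<bar> \<le> M"
proof -
  obtain c where c: "c > 0" "c *\<^sub>R x \<in> V" using assms by (auto simp: absorbing_def)
  have "\<bar>f x\<bar> \<le> 1 / c" if "f \<in> polar V" for f
  proof -
    have "\<bar>f (c *\<^sub>R x)\<bar> \<le> 1" "f (c *\<^sub>R x) = c * f x"
      using that c(2) by (auto simp: polar_def linear_scale)
    then show ?thesis using c(1) by (simp add: abs_mult field_simps)
  qed
  then show ?thesis by blast
qed

text \<open>Polars are compact in the topology of pointwise convergence (Banach--Alaoglu).\<close>

lemma polar_ultralimit: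
  assumes U: "ultrafilter U" and V: "absorbing V" and g: "eventually (\<lambda>i. g i \<in> polar V) U"
  obtains f where "f \<in> polar V" "\<And>x. ((\<lambda>i. g i x) \<longlongrightarrow> f x) U"
proof -
  have "\<exists>l. ((\<lambda>i. g i x) \<longlongrightarrow> l) U" for x
  proof -
    obtain M where "\<forall>f\<in>polar V. \<bar>f x\<bar> \<le> M" using polar_bound[OF V] by blast
    with g have "eventually (\<lambda>i. \<bar>g i x\<bar> \<le> M) U" by (auto elim: eventually_mono)
    with U show ?thesis by (rule ultrafilter_bounded_tendsto)
  qed
  then obtain f where f: "\<And>x. ((\<lambda>i. g i x) \<longlongrightarrow> f x) U" by metis
  have nb: "U \<noteq> bot" using U by (rule ultrafilter_not_bot)
  have "linear f"
  proof (rule linearI)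
    fix x y
    have "((\<lambda>i. g i (x + y)) \<longlongrightarrow> f x + f y) U"
      by (rule Lim_transform_eventually[OF tendsto_add[OF f f]])
        (use g in \<open>auto simp: polar_def linear_add elim: eventually_mono\<close>)
    with f show "f (x + y) = f x + f y" using tendsto_unique[OF nb] by blast
  next
    fix c x
    have "((\<lambda>i. g i (c *\<^sub>R x)) \<longlongrightarrow> c * f x) U"
      by (rule Lim_transform_eventually[OF tendsto_mult_left[OF f]])
        (use g in \<open>auto simp: polar_def linear_scale elim: eventually_mono\<close>)
    then show "f (c *\<^sub>R x) = c *\<^sub>R f x" using tendsto_unique[OF nb f] by simp
  qed
  moreover have "\<bar>f v\<bar> \<le> 1" if "v \<in> V" for v
  proof (rule tendsto_upperbound[OF tendsto_rabs[OF f]])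
    show "eventually (\<lambda>i. \<bar>g i v\<bar> \<le> 1) U"
      using g by eventually_elim (use that in \<open>auto simp: polar_def\<close>)
  qed (rule nb)
  ultimately have "f \<in> polar V" by (simp add: polar_def)
  with f show thesis by (rule that[rotated])
qed

section \<open>Neighbourhoods, closures and limits in the weak topology\<close>

lemma weak_neighbourhood_subset:
  assumes "openin (weak_topology \<tau>) W" "x \<in> W"
  shows "\<exists>F e. finite F \<and> F \<subseteq> dual_space \<tau> \<and> e > 0 \<and> {y. \<forall>f\<in>F. \<bar>f y - f x\<bar> < e} \<subseteq> W"
proof -
  have "generate_topology_on {f -` U | f U. f \<in> dual_space \<tau> \<and> open U} W"
    using assms(1) by (simp add: weak_topology_def openin_topology_generated_by_iff)
  then show ?thesis using assms(2)
  proof (induction rule: generate_topology_on.induct)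
    case Empty
    then show ?case by simp
  next
    case (Int a b)
    then obtain F e where F: "finite F" "F \<subseteq> dual_space \<tau>" "e > 0"
        "{y. \<forall>f\<in>F. \<bar>f y - f x\<bar> < e} \<subseteq> a"
      by blast
    from Int obtain G d where G: "finite G" "G \<subseteq> dual_space \<tau>" "d > 0"
        "{y. \<forall>f\<in>G. \<bar>f y - f x\<bar> < d} \<subseteq> b"
      by blast
    from F(4) G(4) have "{y. \<forall>f\<in>F \<union> G. \<bar>f y - f x\<bar> < min e d} \<subseteq> a \<inter> b"
      by auto
    with F G show ?case
      by (intro exI[of _ "F \<union> G"] exI[of _ "min e d"]) simp
  next
    case (UN K)
    then obtain k where "k \<in> K" "x \<in> k" by blast
    with UN.IH[of k] show ?case by (meson Union_upper order_trans)
  next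
    case (Basis s)
    then obtain f U where s: "s = f -` U" "f \<in> dual_space \<tau>" "open U" by auto
    with Basis obtain e where "e > 0" "\<And>r. \<bar>r - f x\<bar> < e \<Longrightarrow> r \<in> U"
      by (auto simp: open_dist dist_real_def)
    with s show ?case by (intro exI[of _ "{f}"] exI[of _ e]) auto
  qed
qed

lemma openin_weak_neighbourhood:
  assumes "finite F" "F \<subseteq> dual_space \<tau>"
  shows "openin (weak_topology \<tau>) {y. \<forall>f\<in>F. \<bar>f y - f x\<bar> < e}"
proof -
  have "openin (weak_topology \<tau>) {y. \<bar>f y - f x\<bar> < e}" if "f \<in> F" for f
  proof -
    have "{y. \<bar>f y - f x\<bar> < e} = f -` ball (f x) e"
      by (auto simp: dist_real_def)
    with that assms show ?thesis
      unfolding weak_topology_def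
      by (intro topology_generated_by_Basis) (auto intro!: exI[of _ f] exI[of _ "ball (f x) e"])
  qed
  then have "openin (weak_topology \<tau>) ((\<Inter>f\<in>F. {y. \<bar>f y - f x\<bar> < e}) \<inter> topspace (weak_topology \<tau>))"
    using assms(1) by (intro openin_INT) auto
  moreover have "(\<Inter>f\<in>F. {y. \<bar>f y - f x\<bar> < e}) \<inter> topspace (weak_topology \<tau>) =
      {y. \<forall>f\<in>F. \<bar>f y - f x\<bar> < e}"
    by auto
  ultimately show ?thesis by simp
qed

lemma weak_closure_iff:
  "x \<in> weak_topology \<tau> closure_of A \<longleftrightarrow>
    (\<forall>F e. finite F \<and> F \<subseteq> dual_space \<tau> \<and> e > 0 \<longrightarrow> (\<exists>a\<in>A. \<forall>f\<in>F. \<bar>f a - f x\<bar> < e))"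
  (is "?L \<longleftrightarrow> ?R")
proof
  assume L: ?L
  show ?R
  proof (intro allI impI)
    fix F and e :: real assume F: "finite F \<and> F \<subseteq> dual_space \<tau> \<and> e > 0"
    then have "openin (weak_topology \<tau>) {y. \<forall>f\<in>F. \<bar>f y - f x\<bar> < e}"
      by (intro openin_weak_neighbourhood) auto
    moreover have "x \<in> {y. \<forall>f\<in>F. \<bar>f y - f x\<bar> < e}" using F by simp
    moreover from L have "\<And>T. x \<in> T \<and> openin (weak_topology \<tau>) T \<Longrightarrow> \<exists>y. y \<in> A \<and> y \<in> T"
      by (simp add: in_closure_of)
    ultimately have "\<exists>y. y \<in> A \<and> y \<in> {y. \<forall>f\<in>F. \<bar>f y - f x\<bar> < e}"
      by (simp only:)
    then show "\<exists>a\<in>A. \<forall>f\<in>F. \<bar>f a - f x\<bar> < e" by blast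
  qed
next
  assume R: ?R
  show ?L
    unfolding in_closure_of
  proof (intro conjI allI impI)
    fix T assume "x \<in> T \<and> openin (weak_topology \<tau>) T"
    then obtain F e where "finite F" "F \<subseteq> dual_space \<tau>" "e > 0" "{y. \<forall>f\<in>F. \<bar>f y - f x\<bar> < e} \<subseteq> T"
      using weak_neighbourhood_subset[of \<tau> T x] by blast
    with R show "\<exists>y. y \<in> A \<and> y \<in> T" by blast
  qed simp
qed

lemma limitin_weak_iff:
  "limitin (weak_topology \<tau>) y x \<F> \<longleftrightarrow> (\<forall>f\<in>dual_space \<tau>. ((\<lambda>n. f (y n)) \<longlongrightarrow> f x) \<F>)"
  (is "?L \<longleftrightarrow> ?R")
proof
  assume L: ?L
  show ?R
  proof (intro ballI tendstoI)
    fix f and e :: real assume "f \<in> dual_space \<tau>" "e > 0"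
    then show "eventually (\<lambda>n. dist (f (y n)) (f x) < e) \<F>"
      using L openin_weak_neighbourhood[of "{f}" \<tau> x e]
      by (auto simp: limitin_def dist_real_def)
  qed
next
  assume R: ?R
  show ?L
    unfolding limitin_def
  proof (intro conjI allI impI)
    fix T assume "openin (weak_topology \<tau>) T \<and> x \<in> T"
    then obtain F e where F: "finite F" "F \<subseteq> dual_space \<tau>" "e > 0"
        "{y. \<forall>f\<in>F. \<bar>f y - f x\<bar> < e} \<subseteq> T"
      using weak_neighbourhood_subset[of \<tau> T x] by blast
    have "eventually (\<lambda>n. \<forall>f\<in>F. \<bar>f (y n) - f x\<bar> < e) \<F>"
      using F(1-3) R by (auto simp: eventually_ball_finite_distrib tendsto_iff dist_real_def)
    then show "eventually (\<lambda>n. y n \<in> T) \<F>"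
      by eventually_elim (use F(4) in auto)
  qed simp
qed

section \<open>Bounded sets\<close>

lemma von_neumann_bounded_subset:
  "von_neumann_bounded \<tau> B \<Longrightarrow> A \<subseteq> B \<Longrightarrow> von_neumann_bounded \<tau> A"
  unfolding von_neumann_bounded_def using subset_trans[of A B] by fast

lemma von_neumann_boundedD:
  assumes "von_neumann_bounded \<tau> B" "openin \<tau> U" "0 \<in> U"
  obtains s where "s > 0" "\<And>t b. t > s \<Longrightarrow> b \<in> B \<Longrightarrow> (1 / t) *\<^sub>R b \<in> U"
proof -
  obtain s where s: "s > 0" "\<And>t. t > s \<Longrightarrow> B \<subseteq> (\<lambda>x. t *\<^sub>R x) ` U"
    using assms unfolding von_neumann_bounded_def by blast
  have "(1 / t) *\<^sub>R b \<in> U" if tb: "t > s" "b \<in> B" for t b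
  proof -
    obtain u where "u \<in> U" "b = t *\<^sub>R u" using s(2)[OF tb(1)] tb(2) by blast
    with s(1) tb(1) show ?thesis by simp
  qed
  with s(1) show thesis by (rule that)
qed

lemma von_neumann_boundedI:
  assumes "\<And>U. openin \<tau> U \<Longrightarrow> 0 \<in> U \<Longrightarrow> \<exists>s>0. \<forall>t>s. \<forall>b\<in>B. (1 / t) *\<^sub>R b \<in> U"
  shows "von_neumann_bounded \<tau> B"
  unfolding von_neumann_bounded_def
proof (intro allI impI)
  fix U assume "openin \<tau> U \<and> 0 \<in> U"
  then obtain s where s: "s > 0" "\<forall>t>s. \<forall>b\<in>B. (1 / t) *\<^sub>R b \<in> U"
    using assms by blast
  have "B \<subseteq> (\<lambda>x. t *\<^sub>R x) ` U" if "t > s" for t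
  proof
    fix b assume "b \<in> B"
    then have "b = t *\<^sub>R ((1 / t) *\<^sub>R b)" "(1 / t) *\<^sub>R b \<in> U"
      using s that by auto
    then show "b \<in> (\<lambda>x. t *\<^sub>R x) ` U" by (rule image_eqI)
  qed
  with s(1) show "\<exists>s>0. \<forall>t>s. B \<subseteq> (\<lambda>x. t *\<^sub>R x) ` U" by blast
qed

lemma von_neumann_bounded_functional:
  assumes lc: "locally_convex_topology \<tau>" and "von_neumann_bounded \<tau> B" and f: "f \<in> dual_space \<tau>"
  shows "\<exists>M. \<forall>b\<in>B. \<bar>f b\<bar> \<le> M"
proof -
  have lin: "linear f" using f by (simp add: dual_space_def)
  obtain s where s: "s > 0" "\<And>t b. t > s \<Longrightarrow> b \<in> B \<Longrightarrow> (1 / t) *\<^sub>R b \<in> {x. \<bar>f x\<bar> < 1}"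
    using von_neumann_boundedD[OF assms(2) dual_space_neighbourhood[OF lc f, of 1]] lin
    by (auto simp: linear_0)
  have "\<bar>f b\<bar> \<le> s + 1" if "b \<in> B" for b
  proof -
    have "\<bar>(1 / (s + 1)) * f b\<bar> < 1"
      using s(2)[of "s+1" b] that lin by (simp add: linear_scale)
    with s(1) show ?thesis by (simp add: abs_mult field_simps)
  qed
  then show ?thesis by blast
qed

lemma von_neumann_bounded_differences:
  assumes lc: "locally_convex_topology \<tau>" and B: "von_neumann_bounded \<tau> B"
  shows "von_neumann_bounded \<tau> {a - b | a b. a \<in> B \<and> b \<in> B}"
proof (rule von_neumann_boundedI)
  fix U assume "openin \<tau> U" "0 \<in> U"
  then obtain V N where N: "openin \<tau> V" "0 \<in> V" "V \<subseteq> N" "N \<subseteq> U" "convex N"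
    using convex_neighbourhood[OF lc] by metis
  obtain s where s: "s > 0" "\<And>t b. t > s \<Longrightarrow> b \<in> B \<Longrightarrow> (1 / t) *\<^sub>R b \<in> V \<inter> {y. - y \<in> V}"
    using von_neumann_boundedD[OF B symmetric_neighbourhood[OF lc N(1,2)]] by metis
  \<comment> \<open>The vector is the midpoint of \<open>a\<close> and \<open>- b\<close>, both
    divided by \<open>t / 2\<close>; hence the doubled threshold.\<close>
  have "(1 / t) *\<^sub>R (a - b) \<in> U" if t: "t > 2 * s" and ab: "a \<in> B" "b \<in> B" for t a b
  proof -
    have "(1 / (t/2)) *\<^sub>R a \<in> N" "- ((1 / (t/2)) *\<^sub>R b) \<in> N"
      using s(2)[of "t/2"] t ab N(3) by auto
    then have "(1/2) *\<^sub>R ((1 / (t/2)) *\<^sub>R a) + (1/2) *\<^sub>R (- ((1 / (t/2)) *\<^sub>R b)) \<in> N"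
      by (intro convexD[OF N(5)]) auto
    then show ?thesis using N(4) by (auto simp: algebra_simps)
  qed
  with s(1) show "\<exists>s>0. \<forall>t>s. \<forall>b\<in>{a - b | a b. a \<in> B \<and> b \<in> B}. (1 / t) *\<^sub>R b \<in> U"
    by (intro exI[of _ "2 * s"]) auto
qed

section \<open>Rosenthal's dichotomy\<close>

definition alternates :: "real \<Rightarrow> real \<Rightarrow> (nat \<Rightarrow> real) \<Rightarrow> nat \<Rightarrow> bool" where
  "alternates lo hi v i \<longleftrightarrow> (if even i then hi \<le> v i else v i \<le> lo)"

text \<open>Functionals serving longer and longer initial segments have a pointwise limit in the
  polar along a free ultrafilter, and the non-strict inequalities in \<open>alternates\<close>
  survive the limit.\<close>

lemma polar_alternates_compactness:
  assumes V: "absorbing V" and ex: "\<And>n. \<exists>f\<in>polar V. \<forall>i<n. alternates lo hi (\<lambda>i. f (w i)) i"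
  shows "\<exists>f\<in>polar V. \<forall>i. alternates lo hi (\<lambda>i. f (w i)) i"
proof -
  obtain U :: "nat filter" where U: "U \<le> sequentially" "ultrafilter U"
    using ultrafilter_exists[of sequentially] by auto
  have nb: "U \<noteq> bot" using U(2) by (rule ultrafilter_not_bot)
  obtain g where g: "\<And>n. g n \<in> polar V" "\<And>n i. i < n \<Longrightarrow> alternates lo hi (\<lambda>i. g n (w i)) i"
    using ex by metis
  obtain f where f: "f \<in> polar V" "\<And>x. ((\<lambda>n. g n x) \<longlongrightarrow> f x) U"
    using polar_ultralimit[OF U(2) V, of g] g(1) by auto
  have "alternates lo hi (\<lambda>i. f (w i)) i" for i
  proof -
    have "eventually (\<lambda>n. i < n) U"
      using U(1) eventually_gt_at_top filter_leD by blast
    then have ev: "eventually (\<lambda>n. alternates lo hi (\<lambda>i. g n (w i)) i) U"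
      by eventually_elim (rule g(2))
    show ?thesis
    proof (cases "even i")
      case True
      with ev have "eventually (\<lambda>n. hi \<le> g n (w i)) U" by (simp add: alternates_def)
      with True show ?thesis
        using tendsto_lowerbound[OF f(2) _ nb] by (simp add: alternates_def)
    next
      case False
      with ev have "eventually (\<lambda>n. g n (w i) \<le> lo) U" by (simp add: alternates_def)
      with False show ?thesis
        using tendsto_upperbound[OF f(2) _ nb] by (simp add: alternates_def)
    qed
  qed
  with f(1) show ?thesis by blast
qed

text \<open>The tree dichotomy is applied to alternation along finite lists. If every finite stage
  of a branch admits a functional, compactness gives a single one for the whole branch; a stage that
  admits none excludes all functionals.\<close>

lemma polar_alternation_dichotomy:
  assumes U: "ultrafilter U" and V: "absorbing V"
  shows "\<exists>G. (\<forall>s. eventually (G s) U) \<and>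
    ((\<forall>u. branch G u \<longrightarrow> (\<exists>f\<in>polar V. \<forall>i. alternates lo hi (\<lambda>i. f (X (u i))) i)) \<or>
     (\<forall>u. branch G u \<longrightarrow> \<not> (\<exists>f\<in>polar V. \<forall>i. alternates lo hi (\<lambda>i. f (X (u i))) i)))"
proof -
  define P where "P s \<longleftrightarrow> (\<exists>f\<in>polar V. \<forall>i<length s. alternates lo hi (\<lambda>i. f (X (s ! i))) i)" for s
  have P: "P (map u [0..<n]) \<longleftrightarrow> (\<exists>f\<in>polar V. \<forall>i<n. alternates lo hi (\<lambda>i. f (X (u i))) i)" for u n
    by (simp add: P_def alternates_def cong: conj_cong)
  obtain G where G: "\<forall>s. eventually (G s) U"
    "(\<forall>u. branch G u \<longrightarrow> (\<forall>n. P (map u [0..<n]))) \<or> (\<forall>u. branch G u \<longrightarrow> (\<exists>n. \<not> P (map u [0..<n])))"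
    using ultrafilter_tree_dichotomy[OF U, of P] by blast
  from G(2) have "(\<forall>u. branch G u \<longrightarrow> (\<exists>f\<in>polar V. \<forall>i. alternates lo hi (\<lambda>i. f (X (u i))) i)) \<or>
     (\<forall>u. branch G u \<longrightarrow> \<not> (\<exists>f\<in>polar V. \<forall>i. alternates lo hi (\<lambda>i. f (X (u i))) i))"
  proof
    assume "\<forall>u. branch G u \<longrightarrow> (\<forall>n. P (map u [0..<n]))"
    then have "\<exists>f\<in>polar V. \<forall>i. alternates lo hi (\<lambda>i. f (X (u i))) i" if "branch G u" for u
      using polar_alternates_compactness[OF V, of lo hi "\<lambda>i. X (u i)"] that unfolding P by simp
    then show ?thesis by simp
  next
    assume "\<forall>u. branch G u \<longrightarrow> (\<exists>n. \<not> P (map u [0..<n]))"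
    then have "\<not> (\<exists>f\<in>polar V. \<forall>i. alternates lo hi (\<lambda>i. f (X (u i))) i)" if "branch G u" for u
      using that unfolding P by simp meson
    then show ?thesis by simp
  qed
  with G(1) show ?thesis by blast
qed

text \<open>The lower and upper limits are finite by boundedness and differ, so two levels fit
  strictly between them. Rational levels keep the possible gaps countable, so that one sequence can
  be diagonalised against all their trees.\<close>

lemma frequently_gap_of_not_Cauchy:
  fixes v :: "nat \<Rightarrow> real"
  assumes bdd: "\<And>n. \<bar>v n\<bar> \<le> M" and "\<not> Cauchy v"
  obtains lo hi :: rat where "lo < hi" "frequently (\<lambda>n. v n \<le> of_rat lo) sequentially"
    "frequently (\<lambda>n. of_rat hi \<le> v n) sequentially"
proof -
  let ?e = "\<lambda>n. ereal (v n)"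
  have "liminf ?e \<noteq> limsup ?e"
  proof
    assume eq: "liminf ?e = limsup ?e"
    then have lim: "?e \<longlonglongrightarrow> limsup ?e"
      by (intro tendsto_iff_Liminf_eq_Limsup[THEN iffD2]) auto
    have "limsup ?e \<le> ereal M"
      by (intro Limsup_bounded) (use bdd in \<open>auto simp: abs_le_iff\<close>)
    moreover have "ereal (- M) \<le> liminf ?e"
      by (intro Liminf_bounded) (use bdd in \<open>auto simp: abs_le_iff minus_le_iff\<close>)
    ultimately obtain l where "limsup ?e = ereal l"
      using eq by (cases "limsup ?e") auto
    with lim have "v \<longlonglongrightarrow> l" by simp
    then show False
      using assms(2) LIMSEQ_imp_Cauchy by blast
  qed
  then have "liminf ?e < limsup ?e"
    using Liminf_le_Limsup[of sequentially ?e] by (simp add: order.strict_iff_order)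
  then obtain a where a: "liminf ?e < ereal a" "ereal a < limsup ?e"
    using ereal_dense2 by blast
  from ereal_dense2[OF a(2)] obtain b where b: "ereal a < ereal b" "ereal b < limsup ?e" by blast
  then have "a < b" by simp
  obtain lo where lo: "a < of_rat lo" "of_rat lo < b" using of_rat_dense[OF \<open>a < b\<close>] by blast
  obtain hi where hi: "of_rat lo < (of_rat hi :: real)" "of_rat hi < b" using of_rat_dense[OF lo(2)] by blast
  show thesis
  proof
    show "lo < hi" using hi(1) by (simp add: of_rat_less)
    show "frequently (\<lambda>n. v n \<le> of_rat lo) sequentially"
    proof (rule ccontr)
      assume "\<not> ?thesis"
      then have "eventually (\<lambda>n. ereal a \<le> ?e n) sequentially"
        unfolding not_frequently by eventually_elim (use lo(1) in auto)
      then have "ereal a \<le> liminf ?e" by (rule Liminf_bounded)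
      with a(1) show False by simp
    qed
    show "frequently (\<lambda>n. of_rat hi \<le> v n) sequentially"
    proof (rule ccontr)
      assume "\<not> ?thesis"
      then have "eventually (\<lambda>n. ?e n \<le> ereal b) sequentially"
        unfolding not_frequently by eventually_elim (use hi(2) in auto)
      then have "limsup ?e \<le> ereal b" by (rule Limsup_bounded)
      with b(2) show False by simp
    qed
  qed
qed

lemma frequently_alternating_subsequence:
  assumes "frequently P sequentially" "frequently Q sequentially"
  shows "\<exists>\<kappa> :: nat \<Rightarrow> nat. strict_mono \<kappa> \<and> N \<le> \<kappa> 0 \<and>
    (\<forall>i. if even i then P (\<kappa> i) else Q (\<kappa> i))"
proof -
  have ex: "\<exists>m>n. P m" "\<exists>m>n. Q m" for n
    using assms by (auto simp: frequently_sequentially) (meson Suc_le_eq)+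
  have "\<exists>\<kappa>. \<forall>i. (N \<le> \<kappa> i \<and> (if even i then P (\<kappa> i) else Q (\<kappa> i))) \<and> \<kappa> i < \<kappa> (Suc i)"
  proof (rule dependent_nat_choice)
    show "\<exists>x. N \<le> x \<and> (if even (0::nat) then P x else Q x)"
      using ex(1)[of N] by (auto dest: less_imp_le)
    show "\<exists>y. (N \<le> y \<and> (if even (Suc n) then P y else Q y)) \<and> x < y"
      if "N \<le> x \<and> (if even n then P x else Q x)" for x n :: nat
    proof (cases "even (Suc n)")
      case True
      obtain m where "x < m" "P m" using ex(1) by blast
      with True that show ?thesis by (intro exI[of _ m]) simp
    next
      case False
      obtain m where "x < m" "Q m" using ex(2) by blast
      with False that show ?thesis by (intro exI[of _ m]) simp
    qed
  qed
  then show ?thesis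
    unfolding strict_mono_Suc_iff by blast
qed

text \<open>Boolean independence of the pairs of level sets at \<open>hi\<close> and
  \<open>lo\<close>, in Rosenthal's sense, with infinite patterns \<open>I\<close> allowed: one
  functional realises the whole pattern at once.\<close>

definition independent_on :: "('a \<Rightarrow> real) set \<Rightarrow> (nat \<Rightarrow> 'a) \<Rightarrow> bool" where
  "independent_on K z \<longleftrightarrow> (\<exists>lo hi. lo < hi \<and>
     (\<forall>I. \<exists>f\<in>K. \<forall>i. if i \<in> I then hi \<le> f (z i) else f (z i) \<le> lo))"

text \<open>
  If one of the trees forces alternation, a branch all of whose subsequences alternate is cut into
  blocks of length three: leaving out the first or the last index of a block decides freely
  whether the middle one is met at an even or at an odd position. Otherwise the values along a
  common branch of all the trees form Cauchy sequences.
\<close>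

theorem rosenthal_dichotomy:
  fixes x :: "nat \<Rightarrow> 'a::real_vector" and V :: "nat \<Rightarrow> 'a set"
  assumes V: "\<And>k. absorbing (V k)"
    and bdd: "\<And>k f. f \<in> polar (V k) \<Longrightarrow> \<exists>M. \<forall>n. \<bar>f (x n)\<bar> \<le> M"
  shows "(\<exists>r. strict_mono r \<and> (\<forall>k. \<forall>f\<in>polar (V k). Cauchy (\<lambda>n. f (x (r n))))) \<or>
    (\<exists>r k. strict_mono r \<and> independent_on (polar (V k)) (x \<circ> r))"
proof -
  obtain U :: "nat filter" where U: "U \<le> sequentially" "ultrafilter U"
    using ultrafilter_exists[of sequentially] by auto
  let ?alt = "\<lambda>k lo hi u. \<exists>f\<in>polar (V k). \<forall>i. alternates lo hi (\<lambda>i. f (x (u i))) i"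
  have "\<forall>j::nat \<times> rat \<times> rat. \<exists>G. (\<forall>s. eventually (G s) U) \<and>
     (case j of (k, lo, hi) \<Rightarrow>
       (\<forall>u. branch G u \<longrightarrow> ?alt k (of_rat lo) (of_rat hi) u) \<or>
       (\<forall>u. branch G u \<longrightarrow> \<not> ?alt k (of_rat lo) (of_rat hi) u))"
    using polar_alternation_dichotomy[OF U(2) V, where X = x] by (auto simp: split_paired_all)
  from choice[OF this] obtain G where G': "\<forall>j. (\<forall>s. eventually (G j s) U) \<and>
     (case j of (k, lo, hi) \<Rightarrow>
       (\<forall>u. branch (G j) u \<longrightarrow> ?alt k (of_rat lo) (of_rat hi) u) \<or>
       (\<forall>u. branch (G j) u \<longrightarrow> \<not> ?alt k (of_rat lo) (of_rat hi) u))" ..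
  have G: "\<And>j s. eventually (G j s) U" using G'[THEN spec, THEN conjunct1] by blast
  have dich: "(\<forall>u. branch (G (k, lo, hi)) u \<longrightarrow> ?alt k (of_rat lo) (of_rat hi) u) \<or>
       (\<forall>u. branch (G (k, lo, hi)) u \<longrightarrow> \<not> ?alt k (of_rat lo) (of_rat hi) u)" for k lo hi
    using G'[rule_format, of "(k, lo, hi)"] by simp
  \<comment> \<open>The trees are indexed through the countability of the triples. The added
    condition makes branches strictly increasing, so that \<open>r\<close> is a sequence of indices
    of a subsequence.\<close>
  let ?H = "\<lambda>j s n. G (from_nat j) s n \<and> (\<forall>m\<in>set s. m < n)"
  have "eventually (?H j s) U" for j s
  proof (rule eventually_conj[OF G])
    have "eventually (\<lambda>n. \<forall>m\<in>set s. m < n) sequentially"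
      by (intro eventually_ball_finite) (auto intro: eventually_gt_at_top)
    then show "eventually (\<lambda>n. \<forall>m\<in>set s. m < n) U"
      using U(1) filter_leD by blast
  qed
  from ultrafilter_hereditary_branch[of U ?H, OF U(2) this] obtain r
    where r: "\<And>j \<kappa>. strict_mono \<kappa> \<Longrightarrow> j \<le> \<kappa> 0 \<Longrightarrow> branch (?H j) (r \<circ> \<kappa>)"
    by blast
  have br: "branch (G (from_nat j)) (r \<circ> \<kappa>)" if "strict_mono \<kappa>" "j \<le> \<kappa> 0" for j \<kappa>
    using r[OF that] by (simp add: branch_def)
  have mono: "strict_mono r"
  proof (rule strict_monoI)
    show "r m < r n" if "m < n" for m n
      using r[of id 0] that by (auto simp: branch_def strict_mono_def)
  qed
  show ?thesis
  proof (cases "\<exists>k lo hi. lo < hi \<and> (\<forall>u. branch (G (k, lo, hi)) u \<longrightarrow> ?alt k (of_rat lo) (of_rat hi) u)")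
    case True
    then obtain k lo hi where lh: "lo < hi"
      and alt: "\<And>u. branch (G (k, lo, hi)) u \<Longrightarrow> ?alt k (of_rat lo) (of_rat hi) u" by blast
    define p where "p n = 3 * n + to_nat (k, lo, hi) + 1" for n
    have ind: "\<exists>f\<in>polar (V k). \<forall>i. if i \<in> I then of_rat hi \<le> f (x (r (p i))) else f (x (r (p i))) \<le> of_rat lo" for I
    proof -
      \<comment> \<open>In block \<open>i\<close> the offsets used are 1 and 2 if \<open>i\<close>
        is in \<open>I\<close>, and 0 and 1 otherwise. The middle index \<open>p i\<close> is thus
        met at the even position \<open>2 * i\<close> (value at least \<open>hi\<close>) or at the
        odd position \<open>2 * i + 1\<close> (value at most \<open>lo\<close>). The summand
        \<open>to_nat (k, lo, hi)\<close> makes \<kappa> start late enough for a branch of this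
        tree.\<close>
      define \<kappa> where "\<kappa> j = 3 * (j div 2) + j mod 2 + (if j div 2 \<in> I then 1 else 0)
        + to_nat (k, lo, hi)" for j
      have "\<kappa> j < \<kappa> (Suc j)" for j
      proof (cases "even j")
        case True
        then obtain m where "j = 2 * m" by blast
        then show ?thesis by (simp add: \<kappa>_def)
      next
        case False
        then obtain m where "j = 2 * m + 1" by (rule oddE)
        then show ?thesis by (simp add: \<kappa>_def)
      qed
      then have "strict_mono \<kappa>" by (simp add: strict_mono_Suc_iff)
      then have "branch (G (k, lo, hi)) (r \<circ> \<kappa>)"
        using br[of \<kappa> "to_nat (k, lo, hi)"] by (simp add: \<kappa>_def)
      from alt[OF this] obtain f where f: "f \<in> polar (V k)"
        "\<And>i. alternates (of_rat lo) (of_rat hi) (\<lambda>i. f (x (r (\<kappa> i)))) i" by auto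
      have "if i \<in> I then of_rat hi \<le> f (x (r (p i))) else f (x (r (p i))) \<le> of_rat lo" for i
      proof (cases "i \<in> I")
        case True
        then have "\<kappa> (2 * i) = p i" by (simp add: \<kappa>_def p_def)
        with True f(2)[of "2 * i"] show ?thesis by (simp add: alternates_def)
      next
        case False
        then have "\<kappa> (2 * i + 1) = p i" by (simp add: \<kappa>_def p_def)
        with False f(2)[of "2 * i + 1"] show ?thesis by (simp add: alternates_def)
      qed
      with f(1) show ?thesis by blast
    qed
    have "independent_on (polar (V k)) (x \<circ> (r \<circ> p))"
      unfolding independent_on_def o_def
    proof (rule exI[of _ "of_rat lo"], rule exI[of _ "of_rat hi"], intro conjI allI)
      show "(of_rat lo :: real) < of_rat hi" using lh by (simp add: of_rat_less)
    qed (rule ind)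
    moreover have "strict_mono (r \<circ> p)"
      by (intro strict_mono_o mono) (simp add: strict_mono_def p_def)
    ultimately show ?thesis by blast
  next
    case False
    \<comment> \<open>Otherwise the values have a rational gap, and a subsequence alternating across
      it, started beyond the code of its triple, is a branch of that tree. Since the tree does not
      force alternation, it forbids it: a contradiction.\<close>
    have "Cauchy (\<lambda>n. f (x (r n)))" if f: "f \<in> polar (V k)" for k f
    proof (rule ccontr)
      assume nc: "\<not> ?thesis"
      obtain M where M: "\<And>n. \<bar>f (x (r n))\<bar> \<le> M" using bdd[OF f] by blast
      from frequently_gap_of_not_Cauchy[OF M nc] obtain lo hi where lh: "lo < hi"
        "frequently (\<lambda>n. f (x (r n)) \<le> of_rat lo) sequentially"
        "frequently (\<lambda>n. of_rat hi \<le> f (x (r n))) sequentially" by blast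
      obtain \<kappa> :: "nat \<Rightarrow> nat" where \<kappa>: "strict_mono \<kappa>" "to_nat (k, lo, hi) \<le> \<kappa> 0"
          "\<And>i. if even i then of_rat hi \<le> f (x (r (\<kappa> i))) else f (x (r (\<kappa> i))) \<le> of_rat lo"
        using frequently_alternating_subsequence[OF lh(3,2), of "to_nat (k, lo, hi)"] by blast
      have "branch (G (k, lo, hi)) (r \<circ> \<kappa>)" using br[OF \<kappa>(1,2)] by simp
      moreover have "?alt k (of_rat lo) (of_rat hi) (r \<circ> \<kappa>)"
        using \<kappa>(3) by (intro bexI[OF _ f] allI) (simp add: alternates_def)
      ultimately show False using False dich[of k lo hi] lh(1) by blast
    qed
    with mono show ?thesis by blast
  qed
qed

section \<open>Sequences in weak closures\<close>

lemma dual_space_polar_sequence: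
  fixes \<rho> :: "'a::real_vector topology"
  assumes lc: "locally_convex_topology \<rho>" and "metrizable_space \<rho>"
  obtains V :: "nat \<Rightarrow> 'a set" where "\<And>k. absorbing (V k)" "antimono V"
    "dual_space \<rho> = (\<Union>k. polar (V k))"
proof -
  obtain V :: "nat \<Rightarrow> 'a set" where V: "\<And>k. openin \<rho> (V k)" "\<And>k. 0 \<in> V k" "antimono V"
    "\<And>W. openin \<rho> W \<Longrightarrow> 0 \<in> W \<Longrightarrow> \<exists>k. V k \<subseteq> W"
    by (rule metrizable_neighbourhood_sequence[OF assms]) (rule that)
  show thesis
    using that[of V] absorbing_neighbourhood[OF lc V(1,2)] V(3)
      dual_space_eq_UN_polar[OF lc V(1,2,4)] by blast
qed

lemma finite_subset_polar:
  assumes "antimono V" "finite F" "F \<subseteq> (\<Union>k. polar (V k))"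
  shows "\<exists>k::nat. F \<subseteq> polar (V k)"
  using assms(2,3)
proof induction
  case empty
  then show ?case by simp
next
  case (insert f F)
  then obtain k l where "F \<subseteq> polar (V k)" "f \<in> polar (V l)" by blast
  moreover have "polar (V k) \<subseteq> polar (V (max k l))" "polar (V l) \<subseteq> polar (V (max k l))"
    by (intro polar_antimono antimonoD[OF assms(1)]; simp)+
  ultimately show ?case by blast
qed

text \<open>Kaplansky: countable tightness of the weak topology, by compactness of finite powers of polars.\<close>

lemma weak_countable_tightness:
  assumes V: "\<And>k::nat. absorbing (V k)" "antimono V"
    and dual: "dual_space \<tau> = (\<Union>k. polar (V k))"
    and x: "x \<in> weak_topology \<tau> closure_of A"
  shows "\<exists>A'\<subseteq>A. countable A' \<and> x \<in> weak_topology \<tau> closure_of A'"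
proof -
  \<comment> \<open>A finite part of \<open>A\<close> approximates \<open>x\<close> on all p-tuples
    of the polar at once. If every finite \<open>A0\<close> were defeated by a tuple
    \<open>f A0\<close>, an ultralimit over the finite subsets would be a tuple \<open>g\<close> of
    dual functionals; some \<open>a\<close> in \<open>A\<close> is within \<open>e\<close> of
    \<open>x\<close> on \<open>g\<close>. But \<open>a\<close> lies in U-many \<open>A0\<close>, and
    the ultrafilter fixes one coordinate where the defeat at \<open>a\<close> occurs, so that it
    persists for \<open>g\<close>.\<close>
  have cover: "\<exists>A0. finite A0 \<and> A0 \<subseteq> A \<and> (\<forall>f. (\<forall>i<p. f i \<in> polar (V k)) \<longrightarrow> (\<exists>a\<in>A0. \<forall>i<p. \<bar>f i a - f i x\<bar> < e))"
    if "e > 0" for k p :: nat and e :: real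
  proof (rule ccontr)
    define C where "C f \<longleftrightarrow> (\<forall>i<p. f i \<in> polar (V k))" for f
    define D where "D A0 f \<longleftrightarrow> (\<exists>a\<in>A0. \<forall>i<p. \<bar>f i a - f i x\<bar> < e)" for A0 and f :: "nat \<Rightarrow> 'a \<Rightarrow> real"
    assume "\<not> ?thesis"
    then have "\<exists>f. C f \<and> \<not> D A0 f" if "finite A0" "A0 \<subseteq> A" for A0
      using that unfolding C_def[symmetric] D_def[symmetric] by blast
    then obtain f where "\<And>A0. finite A0 \<Longrightarrow> A0 \<subseteq> A \<Longrightarrow> C (f A0) \<and> \<not> D A0 (f A0)"
      by metis
    then have f: "\<And>A0 i. finite A0 \<Longrightarrow> A0 \<subseteq> A \<Longrightarrow> i < p \<Longrightarrow> f A0 i \<in> polar (V k)"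
      "\<And>A0 a. finite A0 \<Longrightarrow> A0 \<subseteq> A \<Longrightarrow> a \<in> A0 \<Longrightarrow> \<exists>i<p. \<not> \<bar>f A0 i a - f A0 i x\<bar> < e"
      unfolding C_def D_def by simp_all
    obtain U where U: "U \<le> finite_subsets_at_top A" "ultrafilter U"
      using ultrafilter_exists[of "finite_subsets_at_top A"] by auto
    have ev: "eventually P U" if "eventually P (finite_subsets_at_top A)" for P
      using that U(1) filter_leD by blast
    have "\<exists>g. g \<in> polar (V k) \<and> (\<forall>y. ((\<lambda>A0. f A0 i y) \<longlongrightarrow> g y) U)" if "i < p" for i
    proof -
      have "eventually (\<lambda>A0. f A0 i \<in> polar (V k)) U"
        by (intro ev eventually_finite_subsets_at_top_weakI f that)
      from polar_ultralimit[OF U(2) V(1) this] show ?thesis by metis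
    qed
    then obtain g where g: "\<And>i. i < p \<Longrightarrow> g i \<in> polar (V k)"
      "\<And>i y. i < p \<Longrightarrow> ((\<lambda>A0. f A0 i y) \<longlongrightarrow> g i y) U" by metis
    have "finite (g ` {..<p})" "g ` {..<p} \<subseteq> dual_space \<tau>" using g(1) dual by auto
    with x \<open>e > 0\<close> obtain a where a: "a \<in> A" "\<And>i. i < p \<Longrightarrow> \<bar>g i a - g i x\<bar> < e"
      unfolding weak_closure_iff by (metis imageI lessThan_iff)
    have "eventually (\<lambda>A0. \<exists>i\<in>{..<p}. e \<le> \<bar>f A0 i a - f A0 i x\<bar>) U"
    proof (rule ev)
      show "eventually (\<lambda>A0. \<exists>i\<in>{..<p}. e \<le> \<bar>f A0 i a - f A0 i x\<bar>) (finite_subsets_at_top A)"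
        unfolding eventually_finite_subsets_at_top
      proof (intro exI[of _ "{a}"] conjI allI impI)
        fix Y assume Y: "finite Y \<and> {a} \<subseteq> Y \<and> Y \<subseteq> A"
        then obtain i where "i < p" "\<not> \<bar>f Y i a - f Y i x\<bar> < e" using f(2)[of Y a] by auto
        then show "\<exists>i\<in>{..<p}. e \<le> \<bar>f Y i a - f Y i x\<bar>" by (intro bexI[of _ i]) auto
      qed (use a in auto)
    qed
    from ultrafilter_eventually_Bex[OF U(2) _ this] obtain i where i: "i < p"
      "eventually (\<lambda>A0. e \<le> \<bar>f A0 i a - f A0 i x\<bar>) U" by auto
    have "((\<lambda>A0. \<bar>f A0 i a - f A0 i x\<bar>) \<longlongrightarrow> \<bar>g i a - g i x\<bar>) U"
      by (intro tendsto_intros g i)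
    from tendsto_lowerbound[OF this i(2) ultrafilter_not_bot[OF U(2)]] a(2)[OF i(1)]
    show False by simp
  qed
  have "\<forall>(k::nat) (p::nat) (q::nat). \<exists>A0. finite A0 \<and> A0 \<subseteq> A \<and> (\<forall>f. (\<forall>i<p. f i \<in> polar (V k)) \<longrightarrow>
      (\<exists>a\<in>A0. \<forall>i<p. \<bar>f i a - f i x\<bar> < inverse (real (Suc q))))"
    by (intro allI cover) simp
  then obtain A0 :: "nat \<Rightarrow> nat \<Rightarrow> nat \<Rightarrow> 'a set" where A0': "\<forall>k p q. finite (A0 k p q) \<and>
      A0 k p q \<subseteq> A \<and> (\<forall>f. (\<forall>i<p. f i \<in> polar (V k)) \<longrightarrow>
      (\<exists>a\<in>A0 k p q. \<forall>i<p. \<bar>f i a - f i x\<bar> < inverse (real (Suc q))))"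
    unfolding choice_iff ..
  have A0: "finite (A0 k p q)" "A0 k p q \<subseteq> A" "(\<forall>i<p. f i \<in> polar (V k)) \<longrightarrow>
      (\<exists>a\<in>A0 k p q. \<forall>i<p. \<bar>f i a - f i x\<bar> < inverse (real (Suc q)))" for k p q and f
    using A0'[THEN spec, of k, THEN spec, of p, THEN spec, of q] by blast+
  let ?A' = "\<Union>k p q. A0 k p q"
  have "\<exists>a\<in>?A'. \<forall>f\<in>F. \<bar>f a - f x\<bar> < e" if F: "finite F" "F \<subseteq> dual_space \<tau>" "e > 0" for F e
  proof -
    obtain k where k: "F \<subseteq> polar (V k)"
      using finite_subset_polar[OF V(2) F(1)] F(2) dual by auto
    obtain p and h :: "nat \<Rightarrow> _" where h: "F = h ` {i. i < p}"
      using finite_imp_nat_seg_image_inj_on[OF F(1)] by blast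
    obtain q where q: "inverse (real (Suc q)) < e" using reals_Archimedean[OF F(3)] by blast
    obtain a where "a \<in> A0 k p q" "\<forall>i<p. \<bar>h i a - h i x\<bar> < inverse (real (Suc q))"
      using A0(3)[rule_format, of p h k q] h k by auto
    with q h show ?thesis by (intro bexI[of _ a]) force+
  qed
  then have "x \<in> weak_topology \<tau> closure_of ?A'"
    unfolding weak_closure_iff by blast
  moreover have "countable ?A'" by (intro countable_UN countableI_type countable_finite A0(1))
  moreover have "?A' \<subseteq> A" using A0(2) by blast
  ultimately show ?thesis by blast
qed

lemma alternates_not_Cauchy:
  assumes "lo < hi" "\<And>i. alternates lo hi v i"
  shows "\<not> Cauchy v"
proof
  assume "Cauchy v"
  then obtain M where "\<And>m n. m \<ge> M \<Longrightarrow> n \<ge> M \<Longrightarrow> norm (v m - v n) < hi - lo"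
    using assms(1) unfolding Cauchy_iff by (metis diff_gt_0_iff_gt)
  from this[of "2 * M" "2 * M + 1"] assms(2)[of "2 * M"] assms(2)[of "2 * M + 1"] show False
    by (simp add: alternates_def)
qed

text \<open>Finite intersections of U-large sets are nonempty. The resulting sequence is eventually
  in each of countably many such sets, although it may leave other members of
  \<open>U\<close>.\<close>

lemma eventually_sequence_choice:
  assumes "\<And>n::nat. eventually (Q n) U" "U \<noteq> bot"
  shows "\<exists>a. \<forall>n. \<forall>j\<le>n. Q j (a n)"
proof -
  have "\<exists>a. \<forall>j\<le>n. Q j a" for n
  proof -
    have "eventually (\<lambda>a. \<forall>j\<in>{..n}. Q j a) U"
      by (intro eventually_ball_finite) (auto simp: assms(1))
    then show ?thesis using eventually_happens' assms(2) by fastforce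
  qed
  then show ?thesis by metis
qed

lemma weak_closure_sequence:
  assumes V: "\<And>k::nat. absorbing (V k)" "antimono V"
    and dual: "dual_space \<tau> = (\<Union>k. polar (V k))"
    and x: "x \<in> weak_topology \<tau> closure_of A"
    and Cauchy_subseq: "\<And>y :: nat \<Rightarrow> 'a::real_vector. range y \<subseteq> A \<Longrightarrow>
      \<exists>r. strict_mono r \<and> weakly_Cauchy \<tau> (y \<circ> r)"
  shows "\<exists>y :: nat \<Rightarrow> 'a. range y \<subseteq> A \<and> limitin (weak_topology \<tau>) y x sequentially"
proof -
  obtain A' where A': "A' \<subseteq> A" "countable A'" "x \<in> weak_topology \<tau> closure_of A'"
    using weak_countable_tightness[OF V dual x] by blast
  \<comment> \<open>That \<open>x\<close> lies in the closure of \<open>A'\<close> says that the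
    traces of its neighbourhoods on \<open>A'\<close> generate a proper filter; \<open>U\<close>
    refines it, so it converges weakly to \<open>x\<close> and contains \<open>A'\<close>.\<close>
  have "inf (nhdsin (weak_topology \<tau>) x) (principal A') \<noteq> bot"
    using A'(3) unfolding trivial_limit_def eventually_inf_principal eventually_nhdsin in_closure_of
    by auto
  then obtain U where U: "U \<le> inf (nhdsin (weak_topology \<tau>) x) (principal A')" "ultrafilter U"
    using ultrafilter_exists by blast
  have nb: "U \<noteq> bot" using U(2) by (rule ultrafilter_not_bot)
  have evA: "eventually (\<lambda>a. a \<in> A') U"
    using U(1) by (rule filter_leD) (simp add: eventually_inf_principal)
  have evf: "eventually (\<lambda>a. \<bar>f a - f x\<bar> < e) U" if "f \<in> dual_space \<tau>" "e > 0" for f e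
    using U(1)
  proof (rule filter_leD)
    have "openin (weak_topology \<tau>) {y. \<forall>g\<in>{f}. \<bar>g y - g x\<bar> < e}"
      using that by (intro openin_weak_neighbourhood) auto
    then have "eventually (\<lambda>a. \<bar>f a - f x\<bar> < e) (nhdsin (weak_topology \<tau>) x)"
      unfolding eventually_nhdsin using that by auto
    then show "eventually (\<lambda>a. \<bar>f a - f x\<bar> < e) (inf (nhdsin (weak_topology \<tau>) x) (principal A'))"
      by (auto simp: eventually_inf_principal elim: eventually_mono)
  qed
  have lin: "linear f" if "f \<in> polar (V k)" for f k using that by (simp add: polar_def)
  \<comment> \<open>The levels will be \<open>\<epsilon> m / 2\<close> and
    \<open>\<epsilon> m\<close>: along \<open>U\<close> the values of a functional at
    \<open>a - x\<close> are eventually below the former, while failure of convergence produces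
    values above the latter.\<close>
  define \<epsilon> where "\<epsilon> m = inverse (real (Suc m))" for m
  have \<epsilon>: "\<epsilon> m > 0" for m by (simp add: \<epsilon>_def)
  let ?alt = "\<lambda>k m u. \<exists>f\<in>polar (V k). \<forall>i. alternates (\<epsilon> m / 2) (\<epsilon> m) (\<lambda>i. f (u i - x)) i"
  have "\<forall>j::nat \<times> nat. \<exists>G. (\<forall>s. eventually (G s) U) \<and>
     (case j of (k, m) \<Rightarrow> (\<forall>u. branch G u \<longrightarrow> ?alt k m u) \<or> (\<forall>u. branch G u \<longrightarrow> \<not> ?alt k m u))"
    using polar_alternation_dichotomy[OF U(2) V(1), where X = "\<lambda>a. a - x"]
    by (auto simp: split_paired_all)
  from choice[OF this] obtain G where G': "\<forall>j. (\<forall>s. eventually (G j s) U) \<and>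
     (case j of (k, m) \<Rightarrow> (\<forall>u. branch (G j) u \<longrightarrow> ?alt k m u) \<or> (\<forall>u. branch (G j) u \<longrightarrow> \<not> ?alt k m u))" ..
  have G: "\<And>j s. eventually (G j s) U" using G'[THEN spec, THEN conjunct1] by blast
  have dich: "(\<forall>u. branch (G (k, m)) u \<longrightarrow> ?alt k m u) \<or> (\<forall>u. branch (G (k, m)) u \<longrightarrow> \<not> ?alt k m u)" for k m
    using G'[rule_format, of "(k, m)"] by simp
  \<comment> \<open>A tree forcing alternation, cut down to \<open>A'\<close>, would contain a
    sequence all of whose subsequences are branches and hence alternate, against the weakly Cauchy
    subsequence supplied by the hypothesis.\<close>
  have never: "\<not> ?alt k m u" if "branch (G (k, m)) u" for k m u
  proof -
    have "\<not> (\<forall>u. branch (G (k, m)) u \<longrightarrow> ?alt k m u)"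
    proof
      assume alt: "\<forall>u. branch (G (k, m)) u \<longrightarrow> ?alt k m u"
      have "\<exists>a. \<forall>(j::nat) (\<kappa>::nat \<Rightarrow> nat). strict_mono \<kappa> \<and> j \<le> \<kappa> 0 \<longrightarrow> branch (\<lambda>s b. G (k, m) s b \<and> b \<in> A') (a \<circ> \<kappa>)"
        using ultrafilter_hereditary_branch[OF U(2), of "\<lambda>j s b. G (k, m) s b \<and> b \<in> A'"] G evA
        by (simp add: eventually_conj)
      then obtain a where a: "\<And>\<kappa> :: nat \<Rightarrow> nat. strict_mono \<kappa> \<Longrightarrow>
          branch (\<lambda>s b. G (k, m) s b \<and> b \<in> A') (a \<circ> \<kappa>)"
        by (metis le0)
      have "range a \<subseteq> A"
        using a[of id] A'(1) by (auto simp: branch_def strict_mono_def)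
      then obtain r where r: "strict_mono r" "weakly_Cauchy \<tau> (a \<circ> r)"
        using Cauchy_subseq by blast
      have "branch (G (k, m)) (a \<circ> r)"
        using a[OF r(1)] by (simp add: branch_def)
      then obtain f where f: "f \<in> polar (V k)"
        "\<And>i. alternates (\<epsilon> m / 2) (\<epsilon> m) (\<lambda>i. f ((a \<circ> r) i - x)) i"
        using alt by blast
      have "Cauchy (\<lambda>i. f ((a \<circ> r) i))"
        using r(2) f(1) dual by (auto simp: weakly_Cauchy_def)
      then have "Cauchy (\<lambda>i. f ((a \<circ> r) i - x))"
        unfolding linear_diff[OF lin[OF f(1)]] Cauchy_iff by simp
      with alternates_not_Cauchy[OF _ f(2)] \<epsilon> show False by simp
    qed
    with dich that show ?thesis by blast
  qed
  \<comment> \<open>All nodes of all trees. Here countability of \<open>A'\<close> enters: one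
    sequence can be made eventually admissible at every node.\<close>
  define S where "S = (UNIV :: nat set) \<times> (UNIV :: nat set) \<times> lists A'"
  have S: "countable S" "S \<noteq> {}"
    unfolding S_def using A'(2) by auto
  define Q where "Q n a \<longleftrightarrow> a \<in> A' \<and> (case from_nat_into S n of (k, m, s) \<Rightarrow> G (k, m) s a)" for n a
  have "eventually (Q n) U" for n
    unfolding Q_def by (intro eventually_conj evA, cases "from_nat_into S n") (simp add: G)
  from eventually_sequence_choice[of Q, OF this nb] obtain a where a: "\<And>n j. j \<le> n \<Longrightarrow> Q j (a n)"
    by blast
  have aA: "a n \<in> A'" for n using a[of 0 n] by (simp add: Q_def)
  have aG: "eventually (\<lambda>n. G (k, m) s (a n)) sequentially" if s: "set s \<subseteq> A'" for k m s
  proof -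
    have "(k, m, s) \<in> S" using s by (auto simp: S_def)
    then obtain j where "from_nat_into S j = (k, m, s)"
      using range_from_nat_into[OF S(2,1)] by (metis imageE)
    then show ?thesis
      unfolding eventually_sequentially using a[of j] by (intro exI[of _ j]) (auto simp: Q_def)
  qed
  \<comment> \<open>If this fails for \<open>f\<close>, a branch is built on which \<open>f\<close>
    alternates, contradicting \<open>never\<close>: even positions take terms \<open>a n\<close>
    with a large value, which are eventually admissible at the current node, and odd positions take
    points chosen along \<open>U\<close>, where \<open>f\<close> is close to
    \<open>f x\<close>.\<close>
  have upper: "eventually (\<lambda>n. f (a n) - f x < \<epsilon> m) sequentially" if f: "f \<in> polar (V k)" for f k m
  proof (rule ccontr)
    assume "\<not> ?thesis"
    then have freq: "frequently (\<lambda>n. \<epsilon> m \<le> f (a n) - f x) sequentially"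
      by (simp add: frequently_def not_le)
    have "\<exists>u. \<forall>i. u i \<in> A' \<and> G (k, m) (map u [0..<i]) (u i) \<and> alternates (\<epsilon> m / 2) (\<epsilon> m) (\<lambda>_. f (u i) - f x) i"
    proof (rule dependent_wellorder_choice)
      fix r and u v :: "nat \<Rightarrow> 'a" and i :: nat
      assume "\<And>j. j < i \<Longrightarrow> u j = v j"
      then have eq: "map u [0..<i] = map v [0..<i]" by simp
      show "(r \<in> A' \<and> G (k, m) (map u [0..<i]) r \<and> alternates (\<epsilon> m / 2) (\<epsilon> m) (\<lambda>_. f r - f x) i) =
          (r \<in> A' \<and> G (k, m) (map v [0..<i]) r \<and> alternates (\<epsilon> m / 2) (\<epsilon> m) (\<lambda>_. f r - f x) i)" by (simp only: eq)
    next
      fix i :: nat and u :: "nat \<Rightarrow> 'a"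
      assume IH: "\<And>j. j < i \<Longrightarrow> u j \<in> A' \<and> G (k, m) (map u [0..<j]) (u j) \<and>
          alternates (\<epsilon> m / 2) (\<epsilon> m) (\<lambda>_. f (u j) - f x) j"
      then have sub: "set (map u [0..<i]) \<subseteq> A'" by auto
      show "\<exists>r. r \<in> A' \<and> G (k, m) (map u [0..<i]) r \<and> alternates (\<epsilon> m / 2) (\<epsilon> m) (\<lambda>_. f r - f x) i"
      proof (cases "even i")
        case True
        have "frequently (\<lambda>n. \<epsilon> m \<le> f (a n) - f x \<and> G (k, m) (map u [0..<i]) (a n)) sequentially"
          by (rule frequently_eventually_conj[OF freq aG[OF sub], THEN frequently_mono[rotated]]) auto
        then obtain n where "\<epsilon> m \<le> f (a n) - f x" "G (k, m) (map u [0..<i]) (a n)"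
          using frequently_ex by blast
        with True aA show ?thesis by (intro exI[of _ "a n"]) (simp add: alternates_def)
      next
        case False
        have "f \<in> dual_space \<tau>" using f dual by blast
        then have "eventually (\<lambda>b. b \<in> A' \<and> G (k, m) (map u [0..<i]) b \<and> \<bar>f b - f x\<bar> < \<epsilon> m / 2) U"
          using \<epsilon>[of m] by (intro eventually_conj evA G evf) auto
        then obtain b where b: "b \<in> A'" "G (k, m) (map u [0..<i]) b" "\<bar>f b - f x\<bar> < \<epsilon> m / 2"
          using eventually_happens'[OF nb] by blast
        have "f b - f x \<le> \<epsilon> m / 2" using b(3) by linarith
        with False b(1,2) show ?thesis unfolding alternates_def by (intro exI[of _ b]) simp
      qed
    qed
    then obtain u where u: "\<And>i. G (k, m) (map u [0..<i]) (u i)"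
      "\<And>i. alternates (\<epsilon> m / 2) (\<epsilon> m) (\<lambda>_. f (u i) - f x) i"
      by blast
    have "branch (G (k, m)) u" using u(1) by (simp add: branch_def)
    moreover have "?alt k m u"
      using u(2) by (intro bexI[OF _ f] allI) (simp only: alternates_def linear_diff[OF lin[OF f]])
    ultimately show False using never by blast
  qed
  have "limitin (weak_topology \<tau>) a x sequentially"
    unfolding limitin_weak_iff
  proof (intro ballI tendstoI)
    fix f and e :: real assume "f \<in> dual_space \<tau>" "e > 0"
    then obtain k where f: "f \<in> polar (V k)" using dual by blast
    obtain m where m: "\<epsilon> m < e" unfolding \<epsilon>_def using reals_Archimedean[OF \<open>e > 0\<close>] by blast
    \<comment> \<open>The lower estimate is the upper one for \<open>- f\<close>, which lies in the
      same polar.\<close>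
    from upper[OF f, of m] upper[OF polar_uminus[OF f], of m]
    show "eventually (\<lambda>n. dist (f (a n)) (f x) < e) sequentially"
      by eventually_elim (use m in \<open>auto simp: dist_real_def\<close>)
  qed
  moreover have "range a \<subseteq> A" using aA A'(1) by auto
  ultimately show ?thesis by blast
qed

section \<open>Differences of an independent sequence\<close>

lemma finite_family_convergent_subsequence:
  fixes z :: "nat \<Rightarrow> 'a"
  assumes "finite F" "\<And>f. f \<in> F \<Longrightarrow> \<exists>M. \<forall>n. \<bar>f (z n) :: real\<bar> \<le> M"
  shows "\<exists>r::nat \<Rightarrow> nat. strict_mono r \<and> (\<forall>f\<in>F. convergent (\<lambda>n. f (z (r n))))"
  using assms
proof induction
  case empty
  then show ?case using strict_mono_id by blast
next
  case (insert f F)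
  then obtain r where r: "strict_mono r" "\<And>g. g \<in> F \<Longrightarrow> convergent (\<lambda>n. g (z (r n)))" by auto
  obtain M where M: "\<And>n. \<bar>f (z n)\<bar> \<le> M" using insert.prems by blast
  then have "bounded (range (\<lambda>n. f (z (r n))))"
    by (intro boundedI[of _ M]) auto
  from bounded_imp_convergent_subsequence[OF this] obtain l \<kappa> where
    \<kappa>: "strict_mono \<kappa>" "((\<lambda>n. f (z (r n))) \<circ> \<kappa>) \<longlonglongrightarrow> l" by auto
  have "convergent (\<lambda>n. g (z ((r \<circ> \<kappa>) n)))" if g: "g \<in> insert f F" for g
  proof (cases "g = f")
    case True
    with \<kappa>(2) show ?thesis by (auto simp: convergent_def o_def)
  next
    case False
    with g have "convergent (\<lambda>n. g (z (r n)))" using r(2) by auto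
    from convergent_subseq_convergent[OF this \<kappa>(1)] show ?thesis by (simp add: o_def)
  qed
  moreover have "strict_mono (r \<circ> \<kappa>)" using r(1) \<kappa>(1) by (rule strict_mono_o)
  ultimately show ?case by blast
qed

text \<open>A weak neighbourhood involves finitely many functionals. Along a subsequence on which
  all of them converge, the consecutive differences become small.\<close>

lemma weak_closure_differences:
  assumes "\<And>f. f \<in> dual_space \<tau> \<Longrightarrow> \<exists>M. \<forall>n. \<bar>f (z n)\<bar> \<le> M"
  shows "0 \<in> weak_topology \<tau> closure_of {z i - z j | i j :: nat. i < j}"
  unfolding weak_closure_iff
proof (intro allI impI)
  fix F and e :: real assume F: "finite F \<and> F \<subseteq> dual_space \<tau> \<and> e > 0"
  obtain r where r: "strict_mono r" "\<And>f. f \<in> F \<Longrightarrow> convergent (\<lambda>n. f (z (r n)))"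
    using finite_family_convergent_subsequence[of F z] F assms by blast
  have "eventually (\<lambda>n. \<bar>f (z (r n)) - f (z (r (Suc n)))\<bar> < e) sequentially" if f: "f \<in> F" for f
  proof -
    obtain l where l: "(\<lambda>n. f (z (r n))) \<longlonglongrightarrow> l" using r(2)[OF f] by (auto simp: convergent_def)
    have "(\<lambda>n. f (z (r n)) - f (z (r (Suc n)))) \<longlonglongrightarrow> l - l"
      by (intro tendsto_diff l LIMSEQ_Suc[OF l])
    then show ?thesis using F by (simp add: tendsto_iff dist_real_def)
  qed
  then have "eventually (\<lambda>n. \<forall>f\<in>F. \<bar>f (z (r n)) - f (z (r (Suc n)))\<bar> < e) sequentially"
    using F by (simp add: eventually_ball_finite_distrib)
  then obtain n where n: "\<And>f. f \<in> F \<Longrightarrow> \<bar>f (z (r n)) - f (z (r (Suc n)))\<bar> < e"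
    using eventually_happens' sequentially_bot by blast
  show "\<exists>a\<in>{z i - z j | i j. i < j}. \<forall>f\<in>F. \<bar>f a - f 0\<bar> < e"
  proof (intro bexI[of _ "z (r n) - z (r (Suc n))"] ballI)
    fix f assume "f \<in> F"
    then have "linear f" using F by (auto simp: dual_space_def)
    with n[OF \<open>f \<in> F\<close>] show "\<bar>f (z (r n) - z (r (Suc n))) - f 0\<bar> < e"
      by (simp add: linear_diff linear_0)
  next
    show "z (r n) - z (r (Suc n)) \<in> {z i - z j | i j. i < j}"
      using strict_monoD[OF r(1), of n "Suc n"] by blast
  qed
qed

text \<open>If \<open>p\<close> takes some value infinitely often, that singleton works since
  \<open>q\<close> lies above \<open>p\<close>. Otherwise \<open>p\<close> tends to infinity, and a
  subsequence of disjoint intervals from \<open>p\<close> to \<open>q\<close> can be chosen; their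
  left ends form a set missing all the right ends.\<close>

lemma splitting_set:
  fixes p q :: "nat \<Rightarrow> nat"
  assumes "\<And>n. p n < q n"
  shows "\<exists>I. frequently (\<lambda>n. p n \<in> I \<and> q n \<notin> I) sequentially"
proof (cases "\<exists>c. frequently (\<lambda>n. p n = c) sequentially")
  case True
  then obtain c where "frequently (\<lambda>n. p n = c) sequentially" ..
  then have "frequently (\<lambda>n. p n \<in> {c} \<and> q n \<notin> {c}) sequentially"
    by (rule frequently_mono[rotated]) (use assms less_irrefl in \<open>metis singletonD singletonI\<close>)
  then show ?thesis by blast
next
  case False
  have large: "\<exists>n'>n. q n < p n'" for n
  proof -
    have "eventually (\<lambda>m. \<forall>c\<in>{..q n}. p m \<noteq> c) sequentially"
      using False by (intro eventually_ball_finite) (auto simp: frequently_def)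
    then have "eventually (\<lambda>m. (\<forall>c\<in>{..q n}. p m \<noteq> c) \<and> n < m) sequentially"
      by (rule eventually_conj) (rule eventually_gt_at_top)
    then obtain m where "\<forall>c\<in>{..q n}. p m \<noteq> c" "n < m"
      using eventually_happens' sequentially_bot by blast
    then show ?thesis by (intro exI[of _ m]) (auto simp: not_le[symmetric])
  qed
  have "\<exists>\<kappa>. \<forall>i. True \<and> (\<kappa> i < \<kappa> (Suc i) \<and> q (\<kappa> i) < p (\<kappa> (Suc i)))"
    by (rule dependent_nat_choice) (use large in auto)
  then obtain \<kappa> where \<kappa>: "\<And>i. \<kappa> i < \<kappa> (Suc i)" "\<And>i. q (\<kappa> i) < p (\<kappa> (Suc i))" by blast
  have mono: "strict_mono \<kappa>" using \<kappa>(1) by (simp add: strict_mono_Suc_iff)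
  have "p (\<kappa> i) < p (\<kappa> (Suc i))" for i using assms[of "\<kappa> i"] \<kappa>(2)[of i] by simp
  then have pmono: "strict_mono (\<lambda>i. p (\<kappa> i))" by (simp add: strict_mono_Suc_iff)
  have "q (\<kappa> i) \<noteq> p (\<kappa> l)" for i l
  proof (cases "l \<le> i")
    case True
    then have "p (\<kappa> l) \<le> p (\<kappa> i)" using strict_mono_less_eq[OF pmono, of l i] by simp
    with assms[of "\<kappa> i"] show ?thesis by simp
  next
    case False
    then have "p (\<kappa> (Suc i)) \<le> p (\<kappa> l)" using strict_mono_less_eq[OF pmono, of "Suc i" l] by simp
    with \<kappa>(2)[of i] show ?thesis by simp
  qed
  then have "\<exists>n\<ge>N. p n \<in> range (\<lambda>l. p (\<kappa> l)) \<and> q n \<notin> range (\<lambda>l. p (\<kappa> l))" for N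
    using strict_mono_imp_increasing[OF mono, of N] by (intro exI[of _ "\<kappa> N"]) auto
  then show ?thesis
    by (intro exI[of _ "range (\<lambda>l. p (\<kappa> l))"]) (simp only: frequently_sequentially, blast)
qed

text \<open>Suppose a sequence of differences tends weakly to 0. A splitting set for its pairs of
  indices is a pattern realised by some functional of \<open>K\<close>, and that functional is at
  least \<open>hi - lo\<close> on infinitely many of the differences.\<close>

lemma independent_not_frechet_urysohn:
  fixes z :: "nat \<Rightarrow> 'a::real_vector"
  assumes bdd: "\<And>f. f \<in> dual_space \<tau> \<Longrightarrow> \<exists>M. \<forall>n. \<bar>f (z n)\<bar> \<le> M"
    and ind: "independent_on K z" and K: "K \<subseteq> dual_space \<tau>"
  shows "\<not> frechet_urysohn_space (subtopology (weak_topology \<tau>) (insert 0 {z i - z j | i j. i < j}))"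
    (is "\<not> frechet_urysohn_space (subtopology _ (insert 0 ?D))")
proof
  assume "frechet_urysohn_space (subtopology (weak_topology \<tau>) (insert 0 ?D))"
  moreover have "0 \<in> subtopology (weak_topology \<tau>) (insert 0 ?D) closure_of ?D"
    using weak_closure_differences[OF bdd] by (auto simp: closure_of_subtopology Int_absorb1 subset_insertI)
  moreover have "?D \<subseteq> topspace (subtopology (weak_topology \<tau>) (insert 0 ?D))" by auto
  ultimately obtain y :: "nat \<Rightarrow> 'a" where y: "range y \<subseteq> ?D"
    "limitin (subtopology (weak_topology \<tau>) (insert 0 ?D)) y 0 sequentially"
    unfolding frechet_urysohn_space_def by meson
  have lim: "limitin (weak_topology \<tau>) y 0 sequentially"
    using y(2) by (simp add: limitin_subtopology)
  have "\<forall>n. \<exists>i j. i < j \<and> y n = z i - z j" using y(1) by blast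
  then obtain p q where pq: "\<And>n. p n < q n" "\<And>n. y n = z (p n) - z (q n)" by metis
  obtain I where I: "frequently (\<lambda>n. p n \<in> I \<and> q n \<notin> I) sequentially"
    using splitting_set[of p q] pq(1) by blast
  obtain lo hi where lh: "lo < hi" and "\<And>I. \<exists>f\<in>K. \<forall>i. if i \<in> I then hi \<le> f (z i) else f (z i) \<le> lo"
    using ind unfolding independent_on_def by blast
  then obtain f where f: "f \<in> K" "\<And>i. if i \<in> I then hi \<le> f (z i) else f (z i) \<le> lo" by blast
  then have fd: "f \<in> dual_space \<tau>" using K by blast
  then have lin: "linear f" by (simp add: dual_space_def)
  have "(\<lambda>n. f (y n)) \<longlonglongrightarrow> 0"
    using lim fd lin unfolding limitin_weak_iff by (metis linear_0)
  then have "eventually (\<lambda>n. \<bar>f (y n)\<bar> < hi - lo) sequentially"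
    using lh by (simp add: tendsto_iff dist_real_def)
  from frequently_eventually_frequently[OF I this]
  obtain n where n: "p n \<in> I" "q n \<notin> I" "\<bar>f (y n)\<bar> < hi - lo"
    using frequently_ex by blast
  then have "f (y n) = f (z (p n)) - f (z (q n))" using pq(2) lin by (simp add: linear_diff)
  with n f(2)[of "p n"] f(2)[of "q n"] show False by simp
qed

section \<open>Dominated extension of functionals\<close>

definition sublinear :: "('a::real_vector \<Rightarrow> real) \<Rightarrow> bool" where
  "sublinear p \<longleftrightarrow> (\<forall>x y. p (x + y) \<le> p x + p y) \<and> (\<forall>c\<ge>0. \<forall>x. p (c *\<^sub>R x) = c * p x)"

lemma sublinear_add: "sublinear p \<Longrightarrow> p (x + y) \<le> p x + p y"
  by (simp add: sublinear_def)

lemma sublinear_scale: "sublinear p \<Longrightarrow> c \<ge> 0 \<Longrightarrow> p (c *\<^sub>R x) = c * p x"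
  by (simp add: sublinear_def)

lemma sublinear_0: "sublinear p \<Longrightarrow> p 0 = 0"
  using sublinear_scale[of p 0 0] by simp

lemma sublinear_minus: "sublinear p \<Longrightarrow> - p (- x) \<le> p x"
  using sublinear_add[of p x "- x"] sublinear_0[of p] by simp

text \<open>Common form of the infima used below: over a chain, along a direction, over a graph, and
  in a gauge. An inequality for scaling is enough, because applying it to \<open>1 / c\<close> gives
  the reverse one; the value at 0 follows from scaling by 2.\<close>

lemma sublinear_Inf:
  assumes ne: "\<And>x. S x \<noteq> {}" and bdd: "\<And>x. bdd_below (S x)"
    and add: "\<And>x y s t. s \<in> S x \<Longrightarrow> t \<in> S y \<Longrightarrow> \<exists>r\<in>S (x + y). r \<le> s + t"
    and scale: "\<And>x c s. c > 0 \<Longrightarrow> s \<in> S x \<Longrightarrow> \<exists>r\<in>S (c *\<^sub>R x). r \<le> c * s"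
  shows "sublinear (\<lambda>x. Inf (S x) :: real)"
proof -
  let ?u = "\<lambda>x. Inf (S x)"
  have sub: "?u (x + y) \<le> ?u x + ?u y" for x y
  proof -
    have "?u (x + y) - s \<le> ?u y" if s: "s \<in> S x" for s
    proof (rule cInf_greatest[OF ne])
      fix t assume "t \<in> S y"
      then obtain r where "r \<in> S (x + y)" "r \<le> s + t" using add s by blast
      then show "?u (x + y) - s \<le> t" using cInf_lower[OF _ bdd, of r "x + y"] by simp
    qed
    then have "?u (x + y) - ?u y \<le> ?u x"
      by (intro cInf_greatest[OF ne]) (simp add: algebra_simps)
    then show ?thesis by simp
  qed
  have le: "?u (c *\<^sub>R x) \<le> c * ?u x" if c: "c > 0" for c x
  proof -
    have "?u (c *\<^sub>R x) / c \<le> ?u x"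
    proof (rule cInf_greatest[OF ne])
      fix s assume "s \<in> S x"
      then obtain r where "r \<in> S (c *\<^sub>R x)" "r \<le> c * s" using scale c by blast
      then have "?u (c *\<^sub>R x) \<le> c * s" using cInf_lower[OF _ bdd, of r "c *\<^sub>R x"] by simp
      then show "?u (c *\<^sub>R x) / c \<le> s" using c by (simp add: field_simps)
    qed
    then show ?thesis using c by (simp add: field_simps)
  qed
  have eq: "?u (c *\<^sub>R x) = c * ?u x" if c: "c > 0" for c x
  proof -
    have "?u ((1 / c) *\<^sub>R (c *\<^sub>R x)) \<le> (1 / c) * ?u (c *\<^sub>R x)"
      by (rule le) (use c in simp)
    then have "c * ?u x \<le> ?u (c *\<^sub>R x)" using c by (simp add: field_simps)
    with le[OF c] show ?thesis by (simp add: order.antisym)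
  qed
  have "?u 0 = 0" using eq[of 2 0] by simp
  then have "?u (c *\<^sub>R x) = c * ?u x" if "c \<ge> 0" for c x
    using eq[of c x] that by (cases "c = 0") auto
  with sub show ?thesis by (simp add: sublinear_def)
qed

text \<open>Zorn's lemma: pointwise infima of chains are finite because every sublinear minorant of
  \<open>p\<close> is bounded below by \<open>- p (- x)\<close>.\<close>

lemma minimal_sublinear_exists:
  assumes p: "sublinear p"
  shows "\<exists>q. sublinear q \<and> (\<forall>x. q x \<le> p x) \<and>
    (\<forall>q'. sublinear q' \<longrightarrow> (\<forall>x. q' x \<le> q x) \<longrightarrow> q' = q)"
proof -
  let ?A = "{q. sublinear q \<and> q \<le> p}" and ?P = "\<lambda>a b :: 'a \<Rightarrow> real. b \<le> a"
  have "\<exists>m\<in>?A. \<forall>a\<in>?A. ?P m a \<longrightarrow> a = m"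
  proof (rule predicate_Zorn)
    show "partial_order_on ?A (relation_of ?P ?A)"
      by (rule partial_order_on_relation_ofI) auto
  next
    fix C assume C: "C \<in> Chains (relation_of ?P ?A)"
    then have sub: "C \<subseteq> ?A" and lin: "\<And>g h. g \<in> C \<Longrightarrow> h \<in> C \<Longrightarrow> g \<le> h \<or> h \<le> g"
      unfolding Chains_def relation_of_def by blast+
    show "\<exists>u\<in>?A. \<forall>a\<in>C. ?P a u"
    proof (cases "C = {}")
      case True
      then show ?thesis using p by auto
    next
      case False
      let ?S = "\<lambda>x. (\<lambda>q. q x) ` C"
      have bdd: "bdd_below (?S x)" for x
      proof (rule bdd_belowI2)
        fix q assume "q \<in> C"
        then have q: "sublinear q" "q (- x) \<le> p (- x)" using sub by (auto simp: le_fun_def)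
        then show "- p (- x) \<le> q x" using sublinear_minus[OF q(1), of x] by simp
      qed
      have "sublinear (\<lambda>x. Inf (?S x))"
      proof (rule sublinear_Inf)
        show "?S x \<noteq> {}" for x using False by simp
        show "bdd_below (?S x)" for x by (rule bdd)
        show "\<exists>r\<in>?S (x + y). r \<le> s + t" if mem: "s \<in> ?S x" "t \<in> ?S y" for x y s t
        proof -
          obtain g h where gh: "g \<in> C" "s = g x" "h \<in> C" "t = h y" using mem by blast
          define k where "k = (if g \<le> h then g else h)"
          have k: "k \<in> C" "k \<le> g" "k \<le> h" using gh lin by (auto simp: k_def)
          then have "sublinear k" using sub by auto
          then have "k (x + y) \<le> s + t"
            using sublinear_add[of k x y] le_funD[OF k(2), of x] le_funD[OF k(3), of y] gh by simp
          with k(1) show ?thesis by blast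
        qed
        show "\<exists>r\<in>?S (c *\<^sub>R x). r \<le> c * s" if "c > 0" "s \<in> ?S x" for c x s
        proof -
          obtain g where g: "g \<in> C" "s = g x" using \<open>s \<in> ?S x\<close> by blast
          then have "sublinear g" using sub by auto
          then have "g (c *\<^sub>R x) = c * s" using g that(1) sublinear_scale by fastforce
          with g(1) show ?thesis by (intro bexI[of _ "g (c *\<^sub>R x)"] imageI) auto
        qed
      qed
      moreover have low: "Inf (?S x) \<le> q x" if "q \<in> C" for q x
        using that by (intro cInf_lower bdd) auto
      moreover have "Inf (?S x) \<le> p x" for x
      proof -
        obtain q0 where "q0 \<in> C" using False by blast
        with sub low[of q0 x] show ?thesis by (auto simp: le_fun_def intro: order_trans)
      qed
      ultimately show ?thesis
        by (intro bexI[of _ "\<lambda>x. Inf (?S x)"]) (auto simp: le_fun_def)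
    qed
  qed
  then obtain q where q: "sublinear q" "q \<le> p" "\<And>g. sublinear g \<Longrightarrow> g \<le> p \<Longrightarrow> g \<le> q \<Longrightarrow> g = q"
    by auto
  have "q' = q" if "sublinear q'" "\<forall>x. q' x \<le> q x" for q'
  proof -
    have "q' \<le> q" using that(2) by (simp add: le_fun_def)
    with q(2) show ?thesis by (intro q(3) that(1)) (auto intro: order_trans)
  qed
  with q(1,2) show ?thesis by (auto simp: le_fun_def)
qed

text \<open>For fixed \<open>v\<close>, the infimum over \<open>t \<ge> 0\<close> of
  \<open>q (x + t *\<^sub>R v) - t * q v\<close> is sublinear and, by \<open>t = 0\<close>, at most
  \<open>q\<close>. Minimality makes it equal to \<open>q\<close>, and then \<open>t = 1\<close>
  gives superadditivity.\<close>

lemma minimal_sublinear_linear: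
  assumes q: "sublinear q" and min: "\<And>q'. sublinear q' \<Longrightarrow> (\<And>x. q' x \<le> q x) \<Longrightarrow> q' = q"
  shows "linear q"
proof -
  have super: "q x + q v \<le> q (x + v)" for x v
  proof -
    let ?h = "\<lambda>x t. q (x + t *\<^sub>R v) - t * q v"
    let ?S = "\<lambda>x. ?h x ` {0..}"
    have bdd: "bdd_below (?S x)" for x
    proof (rule bdd_belowI2)
      fix t :: real assume t: "t \<in> {0..}"
      have "q (t *\<^sub>R v) \<le> q (x + t *\<^sub>R v) + q (- x)"
        using sublinear_add[OF q, of "x + t *\<^sub>R v" "- x"] by simp
      then show "- q (- x) \<le> ?h x t" using sublinear_scale[OF q, of t v] t by simp
    qed
    have "sublinear (\<lambda>x. Inf (?S x))"
    proof (rule sublinear_Inf)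
      show "?S x \<noteq> {}" for x by auto
      show "bdd_below (?S x)" for x by (rule bdd)
      show "\<exists>r\<in>?S (x + y). r \<le> a + b" if mem: "a \<in> ?S x" "b \<in> ?S y" for x y a b
      proof -
        obtain s t where st: "s \<ge> 0" "t \<ge> 0" "a = ?h x s" "b = ?h y t" using mem by auto
        have "q (x + y + (s + t) *\<^sub>R v) \<le> q (x + s *\<^sub>R v) + q (y + t *\<^sub>R v)"
          using sublinear_add[OF q, of "x + s *\<^sub>R v" "y + t *\<^sub>R v"] by (simp add: algebra_simps)
        then have "?h (x + y) (s + t) \<le> a + b" using st by (simp add: algebra_simps)
        moreover have "s + t \<in> {0..}" using st by simp
        ultimately show ?thesis by blast
      qed
      show "\<exists>r\<in>?S (c *\<^sub>R x). r \<le> c * a" if "c > 0" "a \<in> ?S x" for c x a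
      proof -
        obtain t where t: "t \<ge> 0" "a = ?h x t" using \<open>a \<in> ?S x\<close> by auto
        have "q (c *\<^sub>R x + (c * t) *\<^sub>R v) = c * q (x + t *\<^sub>R v)"
          using sublinear_scale[OF q, of c "x + t *\<^sub>R v"] that(1) by (simp add: algebra_simps)
        then have "?h (c *\<^sub>R x) (c * t) \<le> c * a" unfolding t(2) by (simp add: right_diff_distrib)
        moreover have "c * t \<in> {0..}" using t that(1) by simp
        ultimately show ?thesis by blast
      qed
    qed
    moreover have low: "Inf (?S x) \<le> ?h x t" if "t \<ge> 0" for x t
      using that by (intro cInf_lower bdd) auto
    ultimately have "(\<lambda>x. Inf (?S x)) = q"
      using low[of 0] by (intro min) auto
    then have "q x = Inf (?S x)" by (metis (no_types))
    with low[of 1 x] show ?thesis by simp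
  qed
  then have add: "q (x + y) = q x + q y" for x y
    using sublinear_add[OF q, of x y] super[of x y] by simp
  have neg: "q (- x) = - q x" for x
    using add[of x "- x"] sublinear_0[OF q] by simp
  show ?thesis
  proof (rule linearI[OF add])
    fix c x
    show "q (c *\<^sub>R x) = c *\<^sub>R q x"
    proof (cases "c \<ge> 0")
      case True
      then show ?thesis using sublinear_scale[OF q] by simp
    next
      case False
      then have "q ((- c) *\<^sub>R x) = (- c) * q x" using sublinear_scale[OF q, of "- c" x] by simp
      then show ?thesis using neg[of "c *\<^sub>R x"] by simp
    qed
  qed
qed

text \<open>The functional to be extended is given by its graph \<open>R\<close>.\<close>

theorem hahn_banach_graph:
  assumes p: "sublinear p" and R: "subspace R" and le: "\<And>y c. (y, c) \<in> R \<Longrightarrow> c \<le> p y"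
  shows "\<exists>f. linear f \<and> (\<forall>x. f x \<le> p x) \<and> (\<forall>y c. (y, c) \<in> R \<longrightarrow> f y = c)"
proof -
  \<comment> \<open>The infimal convolution of \<open>p\<close> with the graph is sublinear and lies
    below \<open>p\<close>. At \<open>y\<close> it is at most \<open>c\<close> and at
    \<open>- y\<close> at most \<open>- c\<close>, so every linear minorant takes the value
    \<open>c\<close> at \<open>y\<close>.\<close>
  let ?h = "\<lambda>x (y, c). p (x - y) + c"
  let ?S = "\<lambda>x. ?h x ` R"
  have zero: "(0, 0) \<in> R" using subspace_0[OF R] by (simp add: zero_prod_def)
  have bdd: "bdd_below (?S x)" for x
  proof (rule bdd_belowI2)
    fix yc assume "yc \<in> R"
    then obtain y c where yc: "yc = (y, c)" "(y, c) \<in> R" by (cases yc) auto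
    have "(- y, - c) \<in> R" using subspace_neg[OF R yc(2)] by simp
    then have "- c \<le> p (- y)" by (rule le)
    also have "\<dots> \<le> p (x - y) + p (- x)"
      using sublinear_add[OF p, of "x - y" "- x"] by simp
    finally show "- p (- x) \<le> ?h x yc" by (simp add: yc)
  qed
  have low: "Inf (?S x) \<le> p (x - y) + c" if "(y, c) \<in> R" for x y c
    using that by (intro cInf_lower bdd) force
  have sub: "sublinear (\<lambda>x. Inf (?S x))"
  proof (rule sublinear_Inf)
    show "?S x \<noteq> {}" for x using zero by blast
    show "bdd_below (?S x)" for x by (rule bdd)
    show "\<exists>r\<in>?S (x + y). r \<le> s + t" if mem: "s \<in> ?S x" "t \<in> ?S y" for x y s t
    proof -
      obtain u b v c where st: "(u, b) \<in> R" "s = p (x - u) + b" "(v, c) \<in> R" "t = p (y - v) + c"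
        using mem by auto
      have "(u + v, b + c) \<in> R" using subspace_add[OF R st(1,3)] by simp
      moreover have "p (x + y - (u + v)) + (b + c) \<le> s + t"
        using sublinear_add[OF p, of "x - u" "y - v"] st by (simp add: algebra_simps)
      ultimately show ?thesis by (intro bexI[of _ "?h (x + y) (u + v, b + c)"]) auto
    qed
    show "\<exists>r\<in>?S (a *\<^sub>R x). r \<le> a * s" if "a > 0" "s \<in> ?S x" for a x s
    proof -
      obtain u b where s: "(u, b) \<in> R" "s = p (x - u) + b" using \<open>s \<in> ?S x\<close> by auto
      have "(a *\<^sub>R u, a * b) \<in> R" using subspace_scale[OF R s(1), of a] by simp
      moreover have "p (a *\<^sub>R x - a *\<^sub>R u) + a * b \<le> a * s"
        using sublinear_scale[OF p, of a "x - u"] that(1) s by (simp add: algebra_simps)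
      ultimately show ?thesis by (intro bexI[of _ "?h (a *\<^sub>R x) (a *\<^sub>R u, a * b)"]) auto
    qed
  qed
  obtain f where f: "sublinear f" "\<And>x. f x \<le> Inf (?S x)"
    "\<forall>q'. sublinear q' \<longrightarrow> (\<forall>x. q' x \<le> f x) \<longrightarrow> q' = f"
    using minimal_sublinear_exists[OF sub] by blast
  have lin: "linear f" using f(3) by (intro minimal_sublinear_linear[OF f(1)]) blast
  have "f x \<le> p x" for x using f(2)[of x] low[OF zero, of x] by simp
  moreover have "f y = c" if yc: "(y, c) \<in> R" for y c
  proof -
    have "(- y, - c) \<in> R" using subspace_neg[OF R yc] by simp
    then have "f (- y) \<le> - c" using f(2)[of "- y"] low[of "- y" "- c" "- y"] sublinear_0[OF p] by simp
    moreover have "f y \<le> c" using f(2)[of y] low[OF yc, of y] sublinear_0[OF p] by simp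
    ultimately show ?thesis using lin by (simp add: linear_neg)
  qed
  ultimately show ?thesis using lin by auto
qed

text \<open>The infimum of this set is the Minkowski gauge of \<open>N\<close> at
  \<open>x\<close>.\<close>

definition gauge_set :: "'a::real_vector set \<Rightarrow> 'a \<Rightarrow> real set" where
  "gauge_set N x = {t. t > 0 \<and> (1 / t) *\<^sub>R x \<in> N}"

lemma sublinear_gauge:
  assumes N: "convex N" "absorbing N"
  shows "sublinear (\<lambda>x. Inf (gauge_set N x))"
proof (rule sublinear_Inf)
  show "gauge_set N x \<noteq> {}" for x
  proof -
    obtain c where "c > 0" "c *\<^sub>R x \<in> N" using N(2) by (auto simp: absorbing_def)
    then have "1 / c \<in> gauge_set N x" by (simp add: gauge_set_def)
    then show ?thesis by blast
  qed
  show "bdd_below (gauge_set N x)" for x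
    by (rule bdd_belowI[of _ 0]) (simp add: gauge_set_def)
  show "\<exists>r\<in>gauge_set N (x + y). r \<le> s + t" if "s \<in> gauge_set N x" "t \<in> gauge_set N y" for x y s t
  proof -
    have st: "s > 0" "t > 0" "(1 / s) *\<^sub>R x \<in> N" "(1 / t) *\<^sub>R y \<in> N"
      using that by (auto simp: gauge_set_def)
    have "(s / (s + t)) *\<^sub>R ((1 / s) *\<^sub>R x) + (t / (s + t)) *\<^sub>R ((1 / t) *\<^sub>R y) \<in> N"
      using st by (intro convexD[OF N(1)]) (auto simp: add_divide_distrib[symmetric])
    then have "(1 / (s + t)) *\<^sub>R (x + y) \<in> N" using st by (simp add: scaleR_right_distrib)
    then have "s + t \<in> gauge_set N (x + y)" using st by (simp add: gauge_set_def)
    then show ?thesis by blast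
  qed
  show "\<exists>r\<in>gauge_set N (c *\<^sub>R x). r \<le> c * s" if "c > 0" "s \<in> gauge_set N x" for c x s
    using that by (intro bexI[of _ "c * s"]) (auto simp: gauge_set_def)
qed

section \<open>l1-sequences\<close>

lemma l1_finite_iff: "a \<in> l1_finite \<longleftrightarrow> finite {i. a i \<noteq> 0}"
proof -
  have "(\<lambda>i. \<bar>a i\<bar>) summable_on UNIV" if "finite {i. a i \<noteq> 0}"
  proof -
    have "(\<lambda>i. \<bar>a i\<bar>) summable_on {i. a i \<noteq> 0}" using that by (rule summable_on_finite)
    then show ?thesis by (rule summable_on_cong_neutral[THEN iffD1, rotated -1]) auto
  qed
  then show ?thesis by (auto simp: l1_finite_def l1_def)
qed

lemma l1_norm_finite:
  assumes "finite S" "{i. a i \<noteq> 0} \<subseteq> S"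
  shows "l1_norm a = (\<Sum>i\<in>S. \<bar>a i\<bar>)"
proof -
  have "l1_norm a = (\<Sum>\<^sub>\<infinity>i\<in>S. \<bar>a i\<bar>)"
    unfolding l1_norm_def using assms(2) by (intro infsum_cong_neutral) auto
  then show ?thesis using assms(1) by simp
qed

lemma l1_operator_finite:
  assumes "finite S" "{i. a i \<noteq> 0} \<subseteq> S"
  shows "l1_operator x a = (\<Sum>i\<in>S. a i *\<^sub>R x i)"
  unfolding l1_operator_def using assms by (intro sum.mono_neutral_left) auto

lemma l1_finite_closed:
  assumes "a \<in> l1_finite" "b \<in> l1_finite"
  shows "(\<lambda>i. a i + b i) \<in> l1_finite" "(\<lambda>i. a i - b i) \<in> l1_finite" "(\<lambda>i. c * a i) \<in> l1_finite"
proof -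
  have fin: "finite ({i. a i \<noteq> 0} \<union> {i. b i \<noteq> 0})" using assms by (simp add: l1_finite_iff)
  show "(\<lambda>i. a i + b i) \<in> l1_finite" "(\<lambda>i. a i - b i) \<in> l1_finite" "(\<lambda>i. c * a i) \<in> l1_finite"
    unfolding l1_finite_iff by (rule finite_subset[OF _ fin]; auto)+
qed

lemma l1_operator_add:
  assumes "a \<in> l1_finite" "b \<in> l1_finite"
  shows "l1_operator x (\<lambda>i. a i + b i) = l1_operator x a + l1_operator x b"
proof -
  let ?S = "{i. a i \<noteq> 0} \<union> {i. b i \<noteq> 0}"
  have S: "finite ?S" using assms by (simp add: l1_finite_iff)
  show ?thesis
    by (subst (1 2 3) l1_operator_finite[OF S]) (auto simp: sum.distrib scaleR_left_distrib)
qed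

lemma l1_operator_diff:
  assumes "a \<in> l1_finite" "b \<in> l1_finite"
  shows "l1_operator x (\<lambda>i. a i - b i) = l1_operator x a - l1_operator x b"
proof -
  let ?S = "{i. a i \<noteq> 0} \<union> {i. b i \<noteq> 0}"
  have S: "finite ?S" using assms by (simp add: l1_finite_iff)
  show ?thesis
    by (subst (1 2 3) l1_operator_finite[OF S]) (auto simp: sum_subtractf scaleR_left_diff_distrib)
qed

lemma l1_operator_scale:
  assumes "a \<in> l1_finite"
  shows "l1_operator x (\<lambda>i. c * a i) = c *\<^sub>R l1_operator x a"
proof -
  have S: "finite {i. a i \<noteq> 0}" using assms by (simp add: l1_finite_iff)
  show ?thesis
    by (subst (1 2) l1_operator_finite[OF S]) (auto simp: scaleR_sum_right)
qed

lemma l1_norm_scale: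
  assumes "a \<in> l1_finite"
  shows "l1_norm (\<lambda>i. c * a i) = \<bar>c\<bar> * l1_norm a"
proof -
  have S: "finite {i. a i \<noteq> 0}" using assms by (simp add: l1_finite_iff)
  show ?thesis
    by (subst (1 2) l1_norm_finite[OF S]) (auto simp: abs_mult sum_distrib_left)
qed

lemma l1_finite_unit: "(\<lambda>j. if j = i then c else 0) \<in> l1_finite"
  by (rule l1_finite_iff[THEN iffD2], rule finite_subset[of _ "{i}"]) auto

lemma l1_operator_unit: "l1_operator x (\<lambda>j. if j = i then c else 0) = c *\<^sub>R x i"
  by (subst l1_operator_finite[of "{i}"]) auto

lemma l1_norm_unit: "l1_norm (\<lambda>j. if j = i then c else 0) = \<bar>c\<bar>"
  by (subst l1_norm_finite[of "{i}"]) auto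

lemma l1_finite_zero: "(\<lambda>i. 0) \<in> l1_finite" "l1_operator x (\<lambda>i. 0) = 0" "l1_norm (\<lambda>i. 0) = 0"
  by (simp_all add: l1_finite_iff l1_operator_def l1_norm_def)

lemma l1_finite_subset: "l1_finite \<subseteq> l1"
  by (auto simp: l1_finite_def)

lemma topspace_l1_finite_topology: "topspace l1_finite_topology = l1_finite"
  using l1_finite_subset
  by (auto simp: l1_finite_topology_def Metric_space.topspace_mtopology[OF Metric_space_l1])

lemma openin_l1_finite_topology_iff:
  "openin l1_finite_topology W \<longleftrightarrow> W \<subseteq> l1_finite \<and>
    (\<forall>a\<in>W. \<exists>e>0. \<forall>b\<in>l1_finite. l1_norm (\<lambda>i. b i - a i) < e \<longrightarrow> b \<in> W)"
proof -
  interpret M: Metric_space l1 l1_dist by (rule Metric_space_l1)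
  interpret S: Submetric l1 l1_dist l1_finite
    by unfold_locales (rule l1_finite_subset)
  have "l1_dist a b = l1_norm (\<lambda>i. b i - a i)" for a b
    by (subst M.commute) (simp add: l1_dist_def)
  then have "S.sub.mball a e = {b \<in> l1_finite. l1_norm (\<lambda>i. b i - a i) < e}" if "a \<in> l1_finite" for a e
    using that unfolding S.sub.mball_def by simp
  then have ball: "S.sub.mball a e \<subseteq> W \<longleftrightarrow> (\<forall>b\<in>l1_finite. l1_norm (\<lambda>i. b i - a i) < e \<longrightarrow> b \<in> W)"
    if "a \<in> l1_finite" for a e
    using that by (simp add: subset_iff) blast
  have "openin l1_finite_topology W \<longleftrightarrow> W \<subseteq> l1_finite \<and> (\<forall>a. a \<in> W \<longrightarrow> (\<exists>e>0. S.sub.mball a e \<subseteq> W))"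
    unfolding l1_finite_topology_def S.mtopology_submetric[symmetric] S.sub.openin_mtopology ..
  also have "\<dots> \<longleftrightarrow> W \<subseteq> l1_finite \<and>
    (\<forall>a\<in>W. \<exists>e>0. \<forall>b\<in>l1_finite. l1_norm (\<lambda>i. b i - a i) < e \<longrightarrow> b \<in> W)"
  proof (rule conj_cong[OF refl])
    assume W: "W \<subseteq> l1_finite"
    show "(\<forall>a. a \<in> W \<longrightarrow> (\<exists>e>0. S.sub.mball a e \<subseteq> W)) \<longleftrightarrow>
      (\<forall>a\<in>W. \<exists>e>0. \<forall>b\<in>l1_finite. l1_norm (\<lambda>i. b i - a i) < e \<longrightarrow> b \<in> W)"
      unfolding Ball_def[of W] by (intro all_cong1 imp_cong refl ex_cong1 conj_cong ball) (use W in auto)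
  qed
  finally show ?thesis .
qed

text \<open>The signs are moved into the vectors, the coefficients are normalised by their sum
  \<open>t\<close> to a convex combination, and the result is contracted towards 0 by the factor
  \<open>t\<close>.\<close>

lemma convex_absolute_combination:
  assumes N: "convex N" "0 \<in> N" and S: "finite S" and y: "\<And>i. i \<in> S \<Longrightarrow> y i \<in> N \<and> - y i \<in> N"
    and c: "(\<Sum>i\<in>S. \<bar>c i\<bar>) \<le> (1::real)"
  shows "(\<Sum>i\<in>S. c i *\<^sub>R y i) \<in> N"
proof -
  define t where "t = (\<Sum>i\<in>S. \<bar>c i\<bar>)"
  show ?thesis
  proof (cases "t = 0")
    case True
    then have "\<forall>i\<in>S. c i = 0" using S by (simp add: t_def sum_nonneg_eq_0_iff)
    then show ?thesis using N(2) by simp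
  next
    case False
    then have t: "t > 0" by (simp add: t_def order_less_le sum_nonneg)
    have "(\<Sum>i\<in>S. (\<bar>c i\<bar> / t) *\<^sub>R (if c i \<ge> 0 then y i else - y i)) \<in> N"
    proof (rule convex_sum[OF S N(1)])
      show "(\<Sum>i\<in>S. \<bar>c i\<bar> / t) = 1"
        using t by (simp add: sum_divide_distrib[symmetric] t_def[symmetric])
    qed (use t y in auto)
    moreover have "(\<Sum>i\<in>S. (\<bar>c i\<bar> / t) *\<^sub>R (if c i \<ge> 0 then y i else - y i)) =
        (1 / t) *\<^sub>R (\<Sum>i\<in>S. c i *\<^sub>R y i)"
      unfolding scaleR_sum_right by (intro sum.cong) auto
    ultimately have "(1 - t) *\<^sub>R 0 + t *\<^sub>R ((1 / t) *\<^sub>R (\<Sum>i\<in>S. c i *\<^sub>R y i)) \<in> N"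
      using t c by (intro convexD[OF N(1)] N(2)) (auto simp: t_def)
    then show ?thesis using t by simp
  qed
qed


text \<open>Boundedness of the sequence gives continuity of the operator. The set \<open>W\<close>
  gives the lower estimate, which by homogeneity yields both injectivity and openness onto the
  image.\<close>

lemma l1_sequenceI:
  assumes lc: "locally_convex_topology \<tau>" and bdd: "von_neumann_bounded \<tau> (range x)"
    and W: "openin \<tau> W" "0 \<in> W" "\<And>a. a \<in> l1_finite \<Longrightarrow> l1_operator x a \<in> W \<Longrightarrow> l1_norm a < 1"
  shows "l1_sequence \<tau> x"
proof -
  let ?T = "l1_operator x"
  have small: "l1_norm (\<lambda>i. b i - a i) < e"
    if "a \<in> l1_finite" "b \<in> l1_finite" "e > 0" "(1 / e) *\<^sub>R ?T b + - ((1 / e) *\<^sub>R ?T a) \<in> W" for a b e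
  proof -
    let ?d = "\<lambda>i. b i - a i"
    have d: "?d \<in> l1_finite" using that(1,2) by (intro l1_finite_closed)
    have "?T (\<lambda>i. (1 / e) * ?d i) \<in> W"
      using that by (simp only: l1_operator_scale[OF d] l1_operator_diff[OF that(2,1)]) (simp add: algebra_simps)
    with W(3) l1_finite_closed(3)[OF d d] have "l1_norm (\<lambda>i. (1 / e) * ?d i) < 1" by blast
    then show ?thesis using \<open>e > 0\<close> by (simp only: l1_norm_scale[OF d]) (simp add: field_simps)
  qed
  have "inj_on ?T l1_finite"
  proof (rule inj_onI)
    fix a b assume ab: "a \<in> l1_finite" "b \<in> l1_finite" "?T a = ?T b"
    then have lt: "l1_norm (\<lambda>i. b i - a i) < e" if "e > 0" for e
      using small[OF ab(1,2) that] W(2) by simp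
    have S: "finite {i. b i - a i \<noteq> 0}" using l1_finite_closed(2)[OF ab(2,1)] by (simp add: l1_finite_iff)
    have nn: "l1_norm (\<lambda>i. b i - a i) \<ge> 0" by (simp add: l1_norm_finite[OF S] sum_nonneg)
    have "l1_norm (\<lambda>i. b i - a i) = 0" using lt[of "l1_norm (\<lambda>i. b i - a i)"] nn by linarith
    then have "{i. b i - a i \<noteq> 0} = {}"
      using S by (auto simp: l1_norm_finite[OF S] sum_nonneg_eq_0_iff)
    then show "a = b" by auto
  qed
  moreover have "continuous_map l1_finite_topology (subtopology \<tau> (?T ` l1_finite)) ?T"
  proof -
    have "continuous_map l1_finite_topology \<tau> ?T"
      unfolding continuous_map_def topspace_l1_finite_topology topspace_locally_convex[OF lc]
    proof (intro conjI allI impI)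
      fix O' assume O': "openin \<tau> O'"
      show "openin l1_finite_topology {a \<in> l1_finite. ?T a \<in> O'}"
        unfolding openin_l1_finite_topology_iff
      proof (intro conjI ballI)
        fix a assume a: "a \<in> {a \<in> l1_finite. ?T a \<in> O'}"
        have "openin \<tau> {y. 1 *\<^sub>R y + ?T a \<in> O'}" by (rule openin_affine_vimage[OF lc O'])
        moreover have "0 \<in> {y. 1 *\<^sub>R y + ?T a \<in> O'}" using a by simp
        ultimately obtain V N where N: "openin \<tau> V" "0 \<in> V" "V \<subseteq> N"
          "N \<subseteq> {y. 1 *\<^sub>R y + ?T a \<in> O'}" "convex N"
          using convex_neighbourhood[OF lc] by metis
        obtain s where s: "s > 0" "\<And>t b. t > s \<Longrightarrow> b \<in> range x \<Longrightarrow> (1 / t) *\<^sub>R b \<in> V \<inter> {y. - y \<in> V}"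
          using von_neumann_boundedD[OF bdd symmetric_neighbourhood[OF lc N(1,2)]] by metis
        define t where "t = s + 1"
        have t: "t > 0" "\<And>i. (1 / t) *\<^sub>R x i \<in> N" "\<And>i. - ((1 / t) *\<^sub>R x i) \<in> N"
          using s(1) s(2)[of t] N(3) by (auto simp: t_def)
        \<comment> \<open>With radius \<open>1 / t\<close>, the image of \<open>b - a\<close> is an
          absolute combination of the vectors \<open>(1 / t) *\<^sub>R x i\<close> with coefficients
          \<open>t * (b i - a i)\<close> of total size at most 1, so it stays in
          \<open>N\<close>.\<close>
        have "b \<in> {a \<in> l1_finite. ?T a \<in> O'}"
          if b: "b \<in> l1_finite" "l1_norm (\<lambda>i. b i - a i) < 1 / t" for b
        proof -
          let ?d = "\<lambda>i. b i - a i"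
          have d: "?d \<in> l1_finite" using a b(1) by (intro l1_finite_closed) auto
          then have S: "finite {i. ?d i \<noteq> 0}" by (simp add: l1_finite_iff)
          have "(\<Sum>i | ?d i \<noteq> 0. \<bar>t * ?d i\<bar>) = t * l1_norm ?d"
            using t(1) by (simp add: l1_norm_finite[OF S] abs_mult sum_distrib_left)
          also have "\<dots> \<le> 1" using b(2) t(1) by (simp add: field_simps)
          finally have "(\<Sum>i | ?d i \<noteq> 0. (t * ?d i) *\<^sub>R ((1 / t) *\<^sub>R x i)) \<in> N"
            using N t by (intro convex_absolute_combination S) auto
          also have "(\<Sum>i | ?d i \<noteq> 0. (t * ?d i) *\<^sub>R ((1 / t) *\<^sub>R x i)) = ?T ?d"
            unfolding l1_operator_def using t(1) by (intro sum.cong) auto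
          finally have "?T ?d + ?T a \<in> O'" using N(4) by auto
          then show ?thesis using a b(1) by (simp add: l1_operator_diff)
        qed
        then show "\<exists>e>0. \<forall>b\<in>l1_finite. l1_norm (\<lambda>i. b i - a i) < e \<longrightarrow> b \<in> {a \<in> l1_finite. ?T a \<in> O'}"
          using t(1) by (intro exI[of _ "1 / t"]) auto
      qed auto
    qed auto
    then show ?thesis
      by (simp add: continuous_map_in_subtopology topspace_l1_finite_topology)
  qed
  moreover have "open_map l1_finite_topology (subtopology \<tau> (?T ` l1_finite)) ?T"
    unfolding open_map_def
  proof (intro allI impI)
    fix Q assume Q: "openin l1_finite_topology Q"
    have "\<exists>Y. openin \<tau> Y \<and> ?T a \<in> Y \<and> Y \<inter> ?T ` l1_finite \<subseteq> ?T ` Q" if a: "a \<in> Q" for a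
    proof -
      obtain e where e: "e > 0" "\<And>b. b \<in> l1_finite \<Longrightarrow> l1_norm (\<lambda>i. b i - a i) < e \<Longrightarrow> b \<in> Q"
        and af: "a \<in> l1_finite"
        using Q a unfolding openin_l1_finite_topology_iff by blast
      let ?Y = "{y. (1 / e) *\<^sub>R y + - ((1 / e) *\<^sub>R ?T a) \<in> W}"
      have "openin \<tau> ?Y" by (rule openin_affine_vimage[OF lc W(1)])
      moreover have "?T a \<in> ?Y" using W(2) by simp
      moreover have "?Y \<inter> ?T ` l1_finite \<subseteq> ?T ` Q"
      proof
        fix y assume "y \<in> ?Y \<inter> ?T ` l1_finite"
        then obtain b where b: "b \<in> l1_finite" "y = ?T b" "?T b \<in> ?Y" by auto
        then have "b \<in> Q" using small[OF af b(1) e(1)] e(2)[OF b(1)] by simp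
        with b show "y \<in> ?T ` Q" by blast
      qed
      ultimately show ?thesis by blast
    qed
    then obtain Y where Y: "\<And>a. a \<in> Q \<Longrightarrow> openin \<tau> (Y a)" "\<And>a. a \<in> Q \<Longrightarrow> ?T a \<in> Y a"
      "\<And>a. a \<in> Q \<Longrightarrow> Y a \<inter> ?T ` l1_finite \<subseteq> ?T ` Q" by metis
    have "Q \<subseteq> l1_finite" using Q by (simp add: openin_l1_finite_topology_iff)
    then have "?T ` Q = (\<Union>a\<in>Q. Y a) \<inter> ?T ` l1_finite" using Y(2,3) by blast
    moreover have "openin \<tau> (\<Union>a\<in>Q. Y a)" using Y(1) by blast
    ultimately show "openin (subtopology \<tau> (?T ` l1_finite)) (?T ` Q)"
      unfolding openin_subtopology by blast
  qed
  ultimately show ?thesis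
    unfolding l1_sequence_def embedding_map_def
    by (intro bijective_open_imp_homeomorphic_map)
      (simp_all add: topspace_l1_finite_topology topspace_locally_convex[OF lc])
qed

text \<open>Continuity at 0, tested on multiples of unit vectors, gives boundedness. The image of
  the open unit ball is relatively open, which provides \<open>W\<close>; injectivity brings
  membership in \<open>W\<close> back to the ball.\<close>

lemma l1_sequenceD:
  assumes lc: "locally_convex_topology \<tau>" and x: "l1_sequence \<tau> x"
  shows "von_neumann_bounded \<tau> (range x)"
    and "\<exists>W. openin \<tau> W \<and> 0 \<in> W \<and> (\<forall>a\<in>l1_finite. l1_operator x a \<in> W \<longrightarrow> l1_norm a < 1)"
proof -
  let ?T = "l1_operator x"
  have hom: "homeomorphic_map l1_finite_topology (subtopology \<tau> (?T ` l1_finite)) ?T"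
    using x by (simp add: l1_sequence_def embedding_map_def topspace_l1_finite_topology)
  have cont: "continuous_map l1_finite_topology \<tau> ?T"
    using homeomorphic_imp_continuous_map[OF hom] by (simp add: continuous_map_in_subtopology)
  have open_map: "open_map l1_finite_topology (subtopology \<tau> (?T ` l1_finite)) ?T"
    by (rule homeomorphic_imp_open_map[OF hom])
  have inj: "inj_on ?T l1_finite"
    using homeomorphic_imp_injective_map[OF hom] by (simp add: topspace_l1_finite_topology)
  show "von_neumann_bounded \<tau> (range x)"
  proof (rule von_neumann_boundedI)
    fix U assume U: "openin \<tau> U" "0 \<in> U"
    have "openin l1_finite_topology {a \<in> l1_finite. ?T a \<in> U}" (is "openin _ ?U")
      using openin_continuous_map_preimage[OF cont U(1)] by (simp add: topspace_l1_finite_topology)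
    then have "\<forall>a\<in>?U. \<exists>e>0. \<forall>b\<in>l1_finite. l1_norm (\<lambda>i. b i - a i) < e \<longrightarrow> b \<in> ?U"
      unfolding openin_l1_finite_topology_iff by (rule conjunct2)
    moreover have "(\<lambda>i. 0) \<in> ?U" using U(2) by (simp add: l1_finite_zero)
    ultimately have "\<exists>e>0. \<forall>b\<in>l1_finite. l1_norm (\<lambda>i. b i - 0) < e \<longrightarrow> b \<in> ?U"
      by (rule bspec)
    then obtain e where e: "e > 0" "\<And>b. b \<in> l1_finite \<Longrightarrow> l1_norm b < e \<Longrightarrow> ?T b \<in> U"
      by auto
    have "(1 / t) *\<^sub>R x i \<in> U" if "t > 1 / e" for t i
    proof -
      have t: "t > 0" using that e(1) by (meson divide_pos_pos less_trans zero_less_one)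
      have "l1_norm (\<lambda>j. if j = i then 1 / t else 0) < e"
        unfolding l1_norm_unit using that t e(1) by (simp add: field_simps)
      from e(2)[OF l1_finite_unit this] show ?thesis by (simp add: l1_operator_unit)
    qed
    then show "\<exists>s>0. \<forall>t>s. \<forall>b\<in>range x. (1 / t) *\<^sub>R b \<in> U"
      using e(1) by (intro exI[of _ "1 / e"]) auto
  qed
  let ?Q = "{a \<in> l1_finite. l1_norm a < 1}"
  have "openin l1_finite_topology ?Q"
    unfolding openin_l1_finite_topology_iff
  proof (intro conjI ballI)
    fix a assume a: "a \<in> ?Q"
    have "l1_norm b < 1" if b: "b \<in> l1_finite" "l1_norm (\<lambda>i. b i - a i) < 1 - l1_norm a" for b
    proof -
      let ?S = "{i. a i \<noteq> 0} \<union> {i. b i \<noteq> 0}"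
      have S: "finite ?S" using a b(1) by (simp add: l1_finite_iff)
      have "l1_norm b = (\<Sum>i\<in>?S. \<bar>b i\<bar>)" by (rule l1_norm_finite[OF S]) auto
      also have "\<dots> \<le> (\<Sum>i\<in>?S. \<bar>b i - a i\<bar> + \<bar>a i\<bar>)" by (rule sum_mono) simp
      also have "\<dots> = (\<Sum>i\<in>?S. \<bar>b i - a i\<bar>) + (\<Sum>i\<in>?S. \<bar>a i\<bar>)" by (rule sum.distrib)
      also have "(\<Sum>i\<in>?S. \<bar>a i\<bar>) = l1_norm a" by (rule l1_norm_finite[OF S, symmetric]) auto
      also have "(\<Sum>i\<in>?S. \<bar>b i - a i\<bar>) = l1_norm (\<lambda>i. b i - a i)"
        by (rule l1_norm_finite[OF S, symmetric]) auto
      finally show ?thesis using b(2) by simp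
    qed
    then show "\<exists>e>0. \<forall>b\<in>l1_finite. l1_norm (\<lambda>i. b i - a i) < e \<longrightarrow> b \<in> ?Q"
      using a by (intro exI[of _ "1 - l1_norm a"]) auto
  qed auto
  then have "openin (subtopology \<tau> (?T ` l1_finite)) (?T ` ?Q)"
    using open_map by (simp add: open_map_def)
  then obtain W where W: "openin \<tau> W" "?T ` ?Q = W \<inter> ?T ` l1_finite"
    unfolding openin_subtopology by blast
  have "?T (\<lambda>i. 0) \<in> ?T ` ?Q" by (rule imageI) (simp add: l1_finite_zero)
  then have "0 \<in> W" using W(2) by (simp add: l1_finite_zero)
  moreover have "l1_norm a < 1" if a: "a \<in> l1_finite" "?T a \<in> W" for a
  proof -
    have "?T a \<in> ?T ` ?Q" using a W(2) by blast
    then obtain b where "b \<in> ?Q" "?T a = ?T b" by blast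
    then show ?thesis using inj a(1) by (auto dest: inj_onD)
  qed
  ultimately show "\<exists>W. openin \<tau> W \<and> 0 \<in> W \<and> (\<forall>a\<in>l1_finite. ?T a \<in> W \<longrightarrow> l1_norm a < 1)"
    using W(1) by blast
qed

text \<open>The gauge of a convex \<open>N\<close> inside \<open>W\<close> dominates the l1-norm on
  the span of the sequence, so it dominates the functional prescribed there by \<epsilon>.
  Hahn--Banach extends it, and the gauge bound near 0 makes the extension continuous.\<close>

lemma l1_sequence_prescribed_values:
  assumes lc: "locally_convex_topology \<tau>" and x: "l1_sequence \<tau> x"
    and \<epsilon>: "\<And>i. \<bar>\<epsilon> i\<bar> \<le> (1::real)"
  shows "\<exists>f\<in>dual_space \<tau>. \<forall>i. f (x i) = \<epsilon> i"
proof -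
  obtain W where W: "openin \<tau> W" "0 \<in> W" "\<And>a. a \<in> l1_finite \<Longrightarrow> l1_operator x a \<in> W \<Longrightarrow> l1_norm a < 1"
    using l1_sequenceD(2)[OF lc x] by blast
  obtain V N where N: "openin \<tau> V" "0 \<in> V" "V \<subseteq> N" "N \<subseteq> W" "convex N"
    using convex_neighbourhood[OF lc W(1,2)] by metis
  have absN: "absorbing N"
    using absorbing_neighbourhood[OF lc N(1,2)] N(3) by (auto simp: absorbing_def)
  define p where "p y = Inf (gauge_set N y)" for y
  have p: "sublinear p" unfolding p_def[abs_def] by (rule sublinear_gauge[OF N(5) absN])
  \<comment> \<open>The operator is reused for the real sequence \<epsilon>:
    \<open>l1_operator \<epsilon> a\<close> is the sum of the
    \<open>a i * \<epsilon> i\<close>.\<close>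
  define R where "R = (\<lambda>a. (l1_operator x a, l1_operator \<epsilon> a)) ` l1_finite"
  have "subspace R"
  proof (rule subspaceI)
    show "0 \<in> R"
      unfolding R_def
      by (intro image_eqI[of _ _ "\<lambda>i. 0"] l1_finite_zero(1)) (simp add: zero_prod_def l1_finite_zero(2))
    show "u + v \<in> R" if "u \<in> R" "v \<in> R" for u v
      using that unfolding R_def
      by (auto simp: l1_operator_add[symmetric] intro!: image_eqI[OF _ l1_finite_closed(1)])
    show "c *\<^sub>R u \<in> R" if "u \<in> R" for c u
      using that unfolding R_def
      by (auto simp: l1_operator_scale simp del: scaleR_conv_of_real
          intro!: image_eqI[OF _ l1_finite_closed(3)])
  qed
  moreover have "c \<le> p y" if yc: "(y, c) \<in> R" for y c
  proof -
    obtain a where a: "a \<in> l1_finite" "y = l1_operator x a" "c = l1_operator \<epsilon> a"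
      using yc by (auto simp: R_def)
    have S: "finite {i. a i \<noteq> 0}" using a(1) by (simp add: l1_finite_iff)
    have "c \<le> (\<Sum>i | a i \<noteq> 0. \<bar>a i\<bar>)"
      unfolding a(3) l1_operator_def
    proof (rule sum_mono)
      fix i
      have "a i * \<epsilon> i \<le> \<bar>a i\<bar> * \<bar>\<epsilon> i\<bar>" by (metis abs_ge_self abs_mult)
      also have "\<dots> \<le> \<bar>a i\<bar>" using \<epsilon>[of i] by (simp add: mult_left_le)
      finally show "a i *\<^sub>R \<epsilon> i \<le> \<bar>a i\<bar>" by simp
    qed
    also have "\<dots> = l1_norm a" by (simp add: l1_norm_finite[OF S])
    also have "\<dots> \<le> p y"
      unfolding p_def
    proof (rule cInf_greatest)
      obtain s where "s > 0" "s *\<^sub>R y \<in> N" using absN by (auto simp: absorbing_def)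
      then have "1 / s \<in> gauge_set N y" by (simp add: gauge_set_def)
      then show "gauge_set N y \<noteq> {}" by blast
    next
      fix t assume "t \<in> gauge_set N y"
      then have t: "t > 0" "(1 / t) *\<^sub>R y \<in> W" using N(4) by (auto simp: gauge_set_def)
      then have "l1_operator x (\<lambda>i. (1 / t) * a i) \<in> W" by (simp only: l1_operator_scale[OF a(1)] a(2))
      then have "l1_norm (\<lambda>i. (1 / t) * a i) < 1" using W(3) l1_finite_closed(3)[OF a(1,1)] by blast
      then show "l1_norm a \<le> t" using t(1) by (simp only: l1_norm_scale[OF a(1)]) (simp add: field_simps)
    qed
    finally show ?thesis .
  qed
  ultimately have "\<exists>f. linear f \<and> (\<forall>y. f y \<le> p y) \<and> (\<forall>y c. (y, c) \<in> R \<longrightarrow> f y = c)"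
    by (rule hahn_banach_graph[OF p])
  then obtain f where f: "linear f" "\<And>y. f y \<le> p y" "\<And>y c. (y, c) \<in> R \<Longrightarrow> f y = c"
    by auto
  have le1: "f v \<le> 1" if "v \<in> V" for v
  proof -
    have "1 \<in> gauge_set N v" using that N(3) by (auto simp: gauge_set_def)
    then have "p v \<le> 1" unfolding p_def by (rule cInf_lower) (rule bdd_belowI[of _ 0], simp add: gauge_set_def)
    with f(2)[of v] show ?thesis by simp
  qed
  have "\<bar>f v\<bar> \<le> 1" if "v \<in> V \<inter> {y. - y \<in> V}" for v
    using le1[of v] le1[of "- v"] that f(1) by (auto simp: linear_neg abs_le_iff)
  then have "f \<in> polar (V \<inter> {y. - y \<in> V})" using f(1) by (simp add: polar_def)
  then have "f \<in> dual_space \<tau>"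
    using polar_subset_dual_space[OF lc symmetric_neighbourhood[OF lc N(1,2)]] by blast
  moreover have "f (x i) = \<epsilon> i" for i
  proof (rule f(3))
    have "(l1_operator x (\<lambda>j. if j = i then 1 else 0), l1_operator \<epsilon> (\<lambda>j. if j = i then 1 else 0)) \<in> R"
      unfolding R_def using l1_finite_unit by (rule imageI)
    then show "(x i, \<epsilon> i) \<in> R" by (simp add: l1_operator_unit)
  qed
  ultimately show ?thesis by blast
qed

lemma l1_sequence_no_weakly_Cauchy_subsequence:
  assumes lc: "locally_convex_topology \<tau>" and x: "l1_sequence \<tau> x" and r: "strict_mono r"
  shows "\<not> weakly_Cauchy \<tau> (x \<circ> r)"
proof -
  \<comment> \<open>The sign is 1 at the even-numbered terms of the subsequence and -1 at all other
    indices, so the functional alternates along \<open>x \<circ> r\<close>.\<close>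
  define \<epsilon> :: "nat \<Rightarrow> real" where "\<epsilon> j = (if \<exists>n. even n \<and> j = r n then 1 else - 1)" for j
  have "\<exists>f\<in>dual_space \<tau>. \<forall>i. f (x i) = \<epsilon> i"
    by (rule l1_sequence_prescribed_values[OF lc x]) (simp add: \<epsilon>_def)
  then obtain f where f: "f \<in> dual_space \<tau>" "\<And>i. f (x i) = \<epsilon> i" by blast
  have "alternates (- 1) 1 (\<lambda>n. f ((x \<circ> r) n)) i" for i
    using strict_mono_eq[OF r] by (auto simp: alternates_def f(2) \<epsilon>_def)
  then have "\<not> Cauchy (\<lambda>n. f ((x \<circ> r) n))" by (intro alternates_not_Cauchy[of "- 1" 1]) auto
  with f(1) show ?thesis by (auto simp: weakly_Cauchy_def)
qed

text \<open>Rosenthal's argument: \<open>f\<close> and \<open>g\<close> realise opposite patterns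
  given by the signs of the coefficients. In \<open>f - g\<close> the position of the gap cancels,
  and each coordinate contributes at least \<open>(hi - lo) * \<bar>a i\<bar>\<close>.\<close>

lemma independent_imp_l1_sequence:
  assumes lc: "locally_convex_topology \<tau>" and bdd: "von_neumann_bounded \<tau> (range z)"
    and V: "openin \<tau> V" "0 \<in> V" and ind: "independent_on (polar V) z"
  shows "l1_sequence \<tau> z"
proof -
  obtain lo hi where lh: "lo < hi"
    and sep: "\<And>I. \<exists>f\<in>polar V. \<forall>i. if i \<in> I then hi \<le> f (z i) else f (z i) \<le> lo"
    using ind unfolding independent_on_def by blast
  define \<delta> where "\<delta> = (hi - lo) / 2"
  have \<delta>: "\<delta> > 0" using lh by (simp add: \<delta>_def)
  have hl: "hi - lo = 2 * \<delta>" by (simp add: \<delta>_def)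
  \<comment> \<open>On this set functionals of the polar are at most \<open>\<delta> / 2\<close> in
    modulus, so \<open>f - g\<close> is at most \<delta>; against
    \<open>hi - lo = 2 * \<delta>\<close> this bounds the norm by 1/2.\<close>
  let ?W = "{y. (2 / \<delta>) *\<^sub>R y + 0 \<in> V}"
  show ?thesis
  proof (rule l1_sequenceI[OF lc bdd])
    show "openin \<tau> ?W" by (rule openin_affine_vimage[OF lc V(1)])
    show "0 \<in> ?W" using V(2) by simp
    show "l1_norm a < 1" if a: "a \<in> l1_finite" "l1_operator z a \<in> ?W" for a
    proof -
      let ?y = "l1_operator z a"
      have small: "\<bar>f ?y\<bar> \<le> \<delta> / 2" if f: "f \<in> polar V" for f
      proof -
        have "\<bar>f ((2 / \<delta>) *\<^sub>R ?y)\<bar> \<le> 1" using f a(2) by (auto simp: polar_def)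
        then have "(2 / \<delta>) * \<bar>f ?y\<bar> \<le> 1" using f \<delta> by (simp add: polar_def linear_scale abs_mult)
        then show ?thesis using \<delta> by (simp add: field_simps)
      qed
      let ?I = "{i. a i \<ge> 0}"
      obtain f where f: "f \<in> polar V" "\<And>i. if i \<in> ?I then hi \<le> f (z i) else f (z i) \<le> lo"
        using sep by blast
      obtain g where g: "g \<in> polar V" "\<And>i. if i \<in> - ?I then hi \<le> g (z i) else g (z i) \<le> lo"
        using sep by blast
      have lin: "linear f" "linear g" using f g by (auto simp: polar_def)
      have S: "finite {i. a i \<noteq> 0}" using a(1) by (simp add: l1_finite_iff)
      have "(hi - lo) * l1_norm a = (\<Sum>i | a i \<noteq> 0. (hi - lo) * \<bar>a i\<bar>)"
        by (simp add: l1_norm_finite[OF S] sum_distrib_left)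
      also have "\<dots> \<le> (\<Sum>i | a i \<noteq> 0. a i * (f (z i) - g (z i)))"
      proof (rule sum_mono)
        fix i
        show "(hi - lo) * \<bar>a i\<bar> \<le> a i * (f (z i) - g (z i))"
        proof (cases "a i \<ge> 0")
          case True
          then have "hi - lo \<le> f (z i) - g (z i)" using f(2)[of i] g(2)[of i] by simp
          from mult_left_mono[OF this True] True show ?thesis by (simp add: mult.commute)
        next
          case False
          then have "hi - lo \<le> g (z i) - f (z i)" using f(2)[of i] g(2)[of i] by simp
          from mult_left_mono[OF this, of "- a i"] False show ?thesis by (simp add: algebra_simps)
        qed
      qed
      also have "\<dots> = f ?y - g ?y"
        using lin by (simp add: l1_operator_def linear_sum linear_scale algebra_simps sum_subtractf)
      also have "\<dots> \<le> \<delta>" using small[OF f(1)] small[OF g(1)] by linarith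
      finally have "2 * \<delta> * l1_norm a \<le> \<delta> * 1" by (simp add: hl)
      then have "2 * l1_norm a \<le> 1" using \<delta> by (simp add: mult.assoc mult.left_commute)
      then show ?thesis by simp
    qed
  qed
qed


section \<open>The equivalences\<close>

lemma weakly_Cauchy_subsequence_or_independent:
  fixes \<tau> :: "'a::real_vector topology" and x :: "nat \<Rightarrow> 'a"
  assumes lc: "locally_convex_topology \<tau>" and x: "von_neumann_bounded \<tau> (range x)"
    and V: "\<And>k::nat. absorbing (V k)" and dual: "dual_space \<tau> = (\<Union>k. polar (V k))"
  shows "(\<exists>r. strict_mono r \<and> weakly_Cauchy \<tau> (x \<circ> r)) \<or>
    (\<exists>r k. strict_mono r \<and> independent_on (polar (V k)) (x \<circ> r))"
proof -
  have "\<exists>M. \<forall>n. \<bar>f (x n)\<bar> \<le> M" if "f \<in> polar (V k)" for k f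
  proof -
    have "f \<in> dual_space \<tau>" using that by (auto simp: dual)
    from von_neumann_bounded_functional[OF lc x this] show ?thesis by auto
  qed
  from rosenthal_dichotomy[OF V this] show ?thesis
    by (simp add: weakly_Cauchy_def dual)
qed

theorem proposition4p4:
  fixes \<tau> :: "'a::real_vector topology"
  assumes "locally_convex_topology \<tau>"
    and "Hausdorff_space \<tau>"
    and "\<exists>\<rho>. locally_convex_topology \<rho> \<and> metrizable_space \<rho> \<and> dual_space \<rho> = dual_space \<tau>"
  shows "((\<forall>B. von_neumann_bounded \<tau> B \<longrightarrow>
              frechet_urysohn_space (subtopology (weak_topology \<tau>) B)) \<longleftrightarrow>
          (\<forall>x :: nat \<Rightarrow> 'a. von_neumann_bounded \<tau> (range x) \<longrightarrow>
              (\<exists>r. strict_mono r \<and> weakly_Cauchy \<tau> (x \<circ> r)))) \<and>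
         (metrizable_space \<tau> \<longrightarrow>
           ((\<forall>x :: nat \<Rightarrow> 'a. von_neumann_bounded \<tau> (range x) \<longrightarrow>
              (\<exists>r. strict_mono r \<and> weakly_Cauchy \<tau> (x \<circ> r))) \<longleftrightarrow>
            \<not> (\<exists>x. l1_sequence \<tau> x)))"
proof -
  obtain \<rho> where \<rho>: "locally_convex_topology \<rho>" "metrizable_space \<rho>" "dual_space \<rho> = dual_space \<tau>"
    using assms(3) by blast
  \<comment> \<open>These come from \<rho> and need not be neighbourhoods for \<tau>; what is kept
    is that they are absorbing and decreasing and that their polars exhaust the common dual.\<close>
  obtain V :: "nat \<Rightarrow> 'a set" where V: "\<And>k. absorbing (V k)" "antimono V"
    "dual_space \<tau> = (\<Union>k. polar (V k))"
    using dual_space_polar_sequence[OF \<rho>(1,2)] \<rho>(3) by metis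
  let ?i = "\<forall>B. von_neumann_bounded \<tau> B \<longrightarrow> frechet_urysohn_space (subtopology (weak_topology \<tau>) B)"
  let ?ii = "\<forall>x :: nat \<Rightarrow> 'a. von_neumann_bounded \<tau> (range x) \<longrightarrow>
    (\<exists>r. strict_mono r \<and> weakly_Cauchy \<tau> (x \<circ> r))"
  have "?ii" if i: "?i"
  proof (intro allI impI)
    fix x :: "nat \<Rightarrow> 'a" assume x: "von_neumann_bounded \<tau> (range x)"
    have "\<not> independent_on (polar (V k)) (x \<circ> r)" for r k
    proof
      let ?z = "x \<circ> r" and ?D = "{(x \<circ> r) i - (x \<circ> r) j | i j. i < j}"
      assume ind: "independent_on (polar (V k)) ?z"
      \<comment> \<open>The point 0 is itself a difference, \<open>x 0 - x 0\<close>.\<close>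
      have "insert 0 ?D \<subseteq> {a - b | a b. a \<in> range x \<and> b \<in> range x}"
        by (auto intro: exI[of _ "x 0"])
      then have "von_neumann_bounded \<tau> (insert 0 ?D)"
        using von_neumann_bounded_subset von_neumann_bounded_differences[OF assms(1) x] by blast
      with i have "frechet_urysohn_space (subtopology (weak_topology \<tau>) (insert 0 ?D))" by blast
      moreover have "\<exists>M. \<forall>n. \<bar>f (?z n)\<bar> \<le> M" if "f \<in> dual_space \<tau>" for f
        using von_neumann_bounded_functional[OF assms(1) x that] by auto
      ultimately show False
        using independent_not_frechet_urysohn[OF _ ind] V(3) by blast
    qed
    then show "\<exists>r. strict_mono r \<and> weakly_Cauchy \<tau> (x \<circ> r)"
      using weakly_Cauchy_subsequence_or_independent[OF assms(1) x V(1,3)] by blast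
  qed
  moreover have "?i" if ii: "?ii"
  proof (intro allI impI)
    fix B assume B: "von_neumann_bounded \<tau> B"
    show "frechet_urysohn_space (subtopology (weak_topology \<tau>) B)"
      unfolding frechet_urysohn_space_def
    proof (intro allI impI)
      fix A x assume "A \<subseteq> topspace (subtopology (weak_topology \<tau>) B) \<and>
        x \<in> subtopology (weak_topology \<tau>) B closure_of A"
      then have A: "A \<subseteq> B" and x: "x \<in> B" "x \<in> weak_topology \<tau> closure_of A"
        by (auto simp: closure_of_subtopology Int_absorb1)
      have "\<exists>r. strict_mono r \<and> weakly_Cauchy \<tau> (y \<circ> r)" if "range y \<subseteq> A" for y :: "nat \<Rightarrow> 'a"
        using ii von_neumann_bounded_subset[OF B] that A by blast
      from weak_closure_sequence[OF V x(2) this] obtain y :: "nat \<Rightarrow> 'a"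
        where y: "range y \<subseteq> A" "limitin (weak_topology \<tau>) y x sequentially" by blast
      then have "y n \<in> B" for n using A by blast
      with y x(1) show "\<exists>y :: nat \<Rightarrow> 'a. range y \<subseteq> A \<and>
          limitin (subtopology (weak_topology \<tau>) B) y x sequentially"
        by (intro exI[of _ y]) (auto simp: limitin_subtopology)
    qed
  qed
  moreover have "?ii \<longleftrightarrow> \<not> (\<exists>x. l1_sequence \<tau> x)" if metr: "metrizable_space \<tau>"
  proof
    assume ii: "?ii"
    show "\<not> (\<exists>x. l1_sequence \<tau> x)"
      using ii l1_sequenceD(1)[OF assms(1)] l1_sequence_no_weakly_Cauchy_subsequence[OF assms(1)]
      by blast
  next
    assume no_l1: "\<not> (\<exists>x. l1_sequence \<tau> x)"
    \<comment> \<open>Now the sets are neighbourhoods for \<tau> itself, as required to turn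
      independence on a polar into an l1-sequence for \<tau>.\<close>
    obtain W :: "nat \<Rightarrow> 'a set" where W: "\<And>k. openin \<tau> (W k)" "\<And>k. 0 \<in> W k" "antimono W"
      "\<And>U. openin \<tau> U \<Longrightarrow> 0 \<in> U \<Longrightarrow> \<exists>k. W k \<subseteq> U"
      using metrizable_neighbourhood_sequence[OF assms(1) metr] by blast
    show "?ii"
    proof (intro allI impI)
      fix x :: "nat \<Rightarrow> 'a" assume x: "von_neumann_bounded \<tau> (range x)"
      have "\<not> independent_on (polar (W k)) (x \<circ> r)" for r k
        using independent_imp_l1_sequence[OF assms(1) von_neumann_bounded_subset[OF x] W(1,2)] no_l1
        by (metis image_comp image_mono top_greatest)
      then show "\<exists>r. strict_mono r \<and> weakly_Cauchy \<tau> (x \<circ> r)"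
        using weakly_Cauchy_subsequence_or_independent[OF assms(1) x
          absorbing_neighbourhood[OF assms(1) W(1,2)] dual_space_eq_UN_polar[OF assms(1) W(1,2,4)]]
        by blast
    qed
  qed
  ultimately show ?thesis by blast
qed

end
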